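(* Let $1<p<\infty$ and $\alpha>1$. Then $$\sum_{n\in\mathbb{N}}a_n^\alpha(\mathcal{H})\le 2^\alpha\,\zeta(\alpha)\,7^{\alpha/p}\,\gamma_p^\alpha\sum_{m\in\mathbb{Z}}\mu_m^\alpha,$$ where $\zeta$ is the Riemann zeta function.
   Context: $\mathbb{R}^+=[0,+\infty)$, $\mathbb{N}=\{1,2,\ldots\}$, $1<p<\infty$, $p'=p/(p-1)$. Products $0\cdot\infty$ are taken to be $0$. $v,w$ are non-negative weight functions on $\mathbb{R}^+$ with $v\in L^{p'}_{\rm loc}(0,\infty)$ and $w\in L^p_{\rm loc}(0,\infty)$. The boundary functions $a(x),b(x)$ satisfy: (i) $a,b$ are differentiable and strictly increasing on $(0,\infty)$; (ii) $a(0)=b(0)=0$, $a(x)<b(x)$ for $0<x<\infty$, $a(\infty)=b(\infty)=\infty$. The Hardy-Steklov operator on $L^p(\mathbb{R}^+)$ is $$\mathcal{H}f(x)=w(x)\int_{a(x)}^{b(x)}f(y)v(y)\,\mathrm{d}y.$$ The approximation numbers of $T:X\to X$ are $a_n(T)=\inf_{K:\,\mathrm{rank}\,K<n}\|T-K\|_{X\to X}$, $n=1,2,\ldots$; here $X=L^p(\mathbb{R}^+)$. The sequence $\{\xi_k\}_{k\in\mathbb{Z}}\subset(0,\infty)$ is defined by $\xi_0=1$, $\xi_k=(a^{-1}\circ b)^k(1)$, $k\in\mathbb{Z}$; so $b(\xi_k)=a(\xi_{k+1})$. The fairway function $\sigma$ satisfies $a(t)<\sigma(t)<b(t)$ and $\int_{a(t)}^{\sigma(t)}v^{p'}(y)\,\mathrm{d}y=\int_{\sigma(t)}^{b(t)}v^{p'}(y)\,\mathrm{d}y$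 for all $t>0$; it is taken to be invertible (a strictly increasing bijection of $(0,\infty)$), with inverse $\sigma^{-1}$. For each $k\in\mathbb{Z}$ a finite increasing sequence $x_j=x_{j(k)}$, $-j_a(k)\le j\le j_b(k)$, is defined by: (1) $x_{-j_a(k)}=\xi_k$, $x_0=\sigma^{-1}(b(\xi_k))=\sigma^{-1}(a(\xi_{k+1}))$, $x_{j_b(k)}=\xi_{k+1}$; (2) if $\sigma^{-1}(a(x_0))\le\xi_k$ then $j_a(k)=1$; (3) if $\sigma^{-1}(b(x_0))\ge\xi_{k+1}$ then $j_b(k)=1$; (4) if $\sigma^{-1}(a(x_0))>\xi_k$ then $j_a(k)>1$ and $x_{j-1}=\sigma^{-1}(a(x_j))$ as long as $x_{j-1}>\xi_k$, for $-j_a(k)+2\le j\le 0$; (5) if $\sigma^{-1}(b(x_0))<\xi_{k+1}$ then $j_b(k)>1$ and $x_{j+1}=\sigma^{-1}(b(x_j))$ as long as $x_{j+1}<\xi_{k+1}$, for $0\le j\le j_b(k)-2$. All these points, over all $k\in\mathbb{Z}$ (with $x_{j_b(k)}$ for $k$ identified with $x_{-j_a(k+1)}$ for $k+1$), are enumerated in increasing order as $\{x_m\}_{m\in\mathbb{Z}}$, so that $m$ runs over the pairs $(k,j)$ with $k\in\mathbb{Z}$, $-j_a(k)\le j\le j_b(k)-1$. Put $$\mu_m:=\biggl(\int_{x_m}^{x_{m+1}}w^p(x)\,\mathrm{d}x\biggr)^{1/p}\biggl(\int_{a(x_m)}^{b(x_{m+1})}v^{p'}(y)\,\mathrm{d}y\biggr)^{1/p'}.$$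 $\gamma_p$ is the constant, depending only on $p$, in the known upper norm estimate $\|\mathcal{H}\|_{L^p\to L^p}\le\gamma_p\sup_{m\in\mathbb{Z}}\mu_m$ (valid for all non-negative weights $v\in L^{p'}_{\rm loc}(0,\infty)$, $w\in L^p_{\rm loc}(0,\infty)$ and all functions $a,b$ that are differentiable and strictly increasing on $(0,\infty)$ with $a(0)=b(0)=0$, $a(x)<b(x)$ for $0<x<\infty$, $a(\infty)=b(\infty)=\infty$). *)

theory Defs
  imports "HOL-Analysis.Analysis"
begin

text \<open>Real powers of extended non-negative reals, used for positive exponents only.\<close>

definition epowr :: "ennreal \<Rightarrow> real \<Rightarrow> ennreal" (infixr "epowr" 80) where
  "x epowr r = (if x = top then top else ennreal (enn2real x powr r))"

definition conj_exp :: "real \<Rightarrow> real" where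
  "conj_exp p = p / (p - 1)"

definition zeta_real :: "real \<Rightarrow> real" where
  "zeta_real s = (\<Sum>n. 1 / real (Suc n) powr s)"


subsection \<open>The space $L^p$ on the half-line and its operators\<close>

text \<open>
  Elements of \<open>L\<^sup>p\<close> are represented by real-valued functions, two of which are identified when
  they agree almost everywhere on \<open>{0..}\<close>; values at negative arguments are irrelevant.
\<close>

abbreviation half_line :: "real measure" where
  "half_line \<equiv> lebesgue_on {0..}"

definition Lp_norm :: "real \<Rightarrow> (real \<Rightarrow> real) \<Rightarrow> ennreal" where
  "Lp_norm p f = (\<integral>\<^sup>+x. ennreal (\<bar>f x\<bar> powr p) \<partial>half_line) epowr (1 / p)"

definition Lp :: "real \<Rightarrow> (real \<Rightarrow> real) set" where
  "Lp p = {f \<in> borel_measurable half_line. Lp_norm p f < top}"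

text \<open>The operator norm takes the value \<open>top\<close> when the operator is unbounded or does not map
  \<open>L\<^sup>p\<close> into itself.\<close>

definition op_norm :: "real \<Rightarrow> ((real \<Rightarrow> real) \<Rightarrow> real \<Rightarrow> real) \<Rightarrow> ennreal" where
  "op_norm p T = (SUP f \<in> {f \<in> Lp p. Lp_norm p f \<le> 1}. Lp_norm p (T f))"

definition Lp_operator :: "real \<Rightarrow> ((real \<Rightarrow> real) \<Rightarrow> real \<Rightarrow> real) \<Rightarrow> bool" where
  "Lp_operator p K \<longleftrightarrow>
     (\<forall>f \<in> Lp p. K f \<in> Lp p) \<and>
     (\<forall>f \<in> Lp p. \<forall>g \<in> Lp p. (AE x in half_line. f x = g x) \<longrightarrow> (AE x in half_line. K f x = K g x)) \<and>
     (\<forall>f \<in> Lp p. \<forall>g \<in> Lp p. AE x in half_line. K (\<lambda>y. f y + g y) x = K f x + K g x) \<and>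
     (\<forall>f \<in> Lp p. \<forall>c. AE x in half_line. K (\<lambda>y. c * f y) x = c * K f x) \<and>
     op_norm p K < top"

text \<open>The rank is the dimension of the range in \<open>L\<^sup>p\<close>, i.e. the least number of elements of
  \<open>L\<^sup>p\<close> whose span contains the range up to null sets (\<open>\<infinity>\<close> if there is none).\<close>

definition Lp_rank :: "real \<Rightarrow> ((real \<Rightarrow> real) \<Rightarrow> real \<Rightarrow> real) \<Rightarrow> enat" where
  "Lp_rank p K = Inf {enat r | r.
     \<exists>e :: nat \<Rightarrow> real \<Rightarrow> real. (\<forall>i<r. e i \<in> Lp p) \<and>
       (\<forall>f \<in> Lp p. \<exists>c :: nat \<Rightarrow> real. AE x in half_line. K f x = (\<Sum>i<r. c i * e i x))}"

definition approx_number :: "real \<Rightarrow> ((real \<Rightarrow> real) \<Rightarrow> real \<Rightarrow> real) \<Rightarrow> nat \<Rightarrow> ennreal" where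
  "approx_number p T n =
     (INF K \<in> {K. Lp_operator p K \<and> Lp_rank p K < enat n}. op_norm p (\<lambda>f x. T f x - K f x))"


subsection \<open>The Hardy--Steklov operator\<close>

definition weight_on :: "real \<Rightarrow> (real \<Rightarrow> real) \<Rightarrow> bool" where
  "weight_on q u \<longleftrightarrow>
     u \<in> borel_measurable half_line \<and> (\<forall>x\<ge>0. 0 \<le> u x) \<and>
     (\<forall>C. compact C \<and> C \<subseteq> {0<..} \<longrightarrow> (\<integral>\<^sup>+x\<in>C. ennreal (u x powr q) \<partial>lebesgue) < top)"

text \<open>The conditions \<open>a(0) = 0\<close> and \<open>a(\<infinity>) = \<infinity>\<close> on boundary functions are read as boundary
  values attained continuously; this makes \<open>a\<close> and \<open>b\<close> bijections of \<open>{0<..}\<close>.\<close>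

definition boundary_function :: "(real \<Rightarrow> real) \<Rightarrow> bool" where
  "boundary_function a \<longleftrightarrow>
     a differentiable_on {0<..} \<and> strict_mono_on {0<..} a \<and>
     a 0 = 0 \<and> (a \<longlongrightarrow> 0) (at_right 0) \<and> filterlim a at_top at_top"

definition boundaries :: "(real \<Rightarrow> real) \<Rightarrow> (real \<Rightarrow> real) \<Rightarrow> bool" where
  "boundaries a b \<longleftrightarrow> boundary_function a \<and> boundary_function b \<and> (\<forall>x>0. a x < b x)"

definition hardy_steklov ::
  "(real \<Rightarrow> real) \<Rightarrow> (real \<Rightarrow> real) \<Rightarrow> (real \<Rightarrow> real) \<Rightarrow> (real \<Rightarrow> real) \<Rightarrow>
    (real \<Rightarrow> real) \<Rightarrow> real \<Rightarrow> real" where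
  "hardy_steklov v w a b f x = w x * (LINT y:{a x..b x}|lebesgue. f y * v y)"

definition fairway ::
  "real \<Rightarrow> (real \<Rightarrow> real) \<Rightarrow> (real \<Rightarrow> real) \<Rightarrow> (real \<Rightarrow> real) \<Rightarrow> (real \<Rightarrow> real) \<Rightarrow> bool" where
  "fairway p v a b \<sigma> \<longleftrightarrow>
     strict_mono_on {0<..} \<sigma> \<and> bij_betw \<sigma> {0<..} {0<..} \<and>
     (\<forall>t>0. a t < \<sigma> t \<and> \<sigma> t < b t \<and>
       (\<integral>\<^sup>+y\<in>{a t..\<sigma> t}. ennreal (v y powr conj_exp p) \<partial>lebesgue) =
       (\<integral>\<^sup>+y\<in>{\<sigma> t..b t}. ennreal (v y powr conj_exp p) \<partial>lebesgue))"

definition hs_setting ::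
  "real \<Rightarrow> (real \<Rightarrow> real) \<Rightarrow> (real \<Rightarrow> real) \<Rightarrow> (real \<Rightarrow> real) \<Rightarrow> (real \<Rightarrow> real) \<Rightarrow> (real \<Rightarrow> real) \<Rightarrow> bool"
  where
  "hs_setting p v w a b \<sigma> \<longleftrightarrow>
     weight_on (conj_exp p) v \<and> weight_on p w \<and> boundaries a b \<and> fairway p v a b \<sigma>"


subsection \<open>The partition points\<close>

abbreviation pos_inv :: "(real \<Rightarrow> real) \<Rightarrow> real \<Rightarrow> real" where
  "pos_inv g \<equiv> the_inv_into {0<..} g"

definition \<xi> :: "(real \<Rightarrow> real) \<Rightarrow> (real \<Rightarrow> real) \<Rightarrow> int \<Rightarrow> real" where
  "\<xi> a b k = (if 0 \<le> k then ((pos_inv a \<circ> b) ^^ nat k) 1 else ((pos_inv b \<circ> a) ^^ nat (- k)) 1)"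

text \<open>
  \<open>block a b \<sigma> k ja jb x\<close>: the points \<open>x j\<close>, \<open>-ja \<le> j \<le> jb\<close>, subdivide \<open>[\<xi>\<^sub>k, \<xi>\<^sub>k\<^sub>+\<^sub>1]\<close> by the
  recursive rules. ``As long as'' also means that the recursion is not stopped too early: the
  point that would follow the last one it produces no longer lies strictly inside the interval.
\<close>

definition block ::
  "(real \<Rightarrow> real) \<Rightarrow> (real \<Rightarrow> real) \<Rightarrow> (real \<Rightarrow> real) \<Rightarrow> int \<Rightarrow> int \<Rightarrow> int \<Rightarrow> (int \<Rightarrow> real) \<Rightarrow> bool" where
  "block a b \<sigma> k ja jb x \<longleftrightarrow>
     x (- ja) = \<xi> a b k \<and> x 0 = pos_inv \<sigma> (b (\<xi> a b k)) \<and> x jb = \<xi> a b (k + 1) \<and>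
     (pos_inv \<sigma> (a (x 0)) \<le> \<xi> a b k \<longrightarrow> ja = 1) \<and>
     (pos_inv \<sigma> (b (x 0)) \<ge> \<xi> a b (k + 1) \<longrightarrow> jb = 1) \<and>
     (pos_inv \<sigma> (a (x 0)) > \<xi> a b k \<longrightarrow> ja > 1 \<and>
        (\<forall>j \<in> {- ja + 2..0}. x (j - 1) = pos_inv \<sigma> (a (x j)) \<and> x (j - 1) > \<xi> a b k) \<and>
        pos_inv \<sigma> (a (x (- ja + 1))) \<le> \<xi> a b k) \<and>
     (pos_inv \<sigma> (b (x 0)) < \<xi> a b (k + 1) \<longrightarrow> jb > 1 \<and>
        (\<forall>j \<in> {0..jb - 2}. x (j + 1) = pos_inv \<sigma> (b (x j)) \<and> x (j + 1) < \<xi> a b (k + 1)) \<and>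
        pos_inv \<sigma> (b (x (jb - 1))) \<ge> \<xi> a b (k + 1))"

text \<open>\<open>x\<close> enumerates, in increasing order, the points of all blocks; the right end of each block
  is the left end of the next one. Such an enumeration is unique up to a shift of the index.\<close>

definition partition_points ::
  "(real \<Rightarrow> real) \<Rightarrow> (real \<Rightarrow> real) \<Rightarrow> (real \<Rightarrow> real) \<Rightarrow> (int \<Rightarrow> real) \<Rightarrow> bool" where
  "partition_points a b \<sigma> x \<longleftrightarrow>
     strict_mono x \<and>
     (\<exists>(ja :: int \<Rightarrow> int) (jb :: int \<Rightarrow> int) (X :: int \<Rightarrow> int \<Rightarrow> real).
        (\<forall>k. block a b \<sigma> k (ja k) (jb k) (X k)) \<and>
        range x = (\<Union>k. X k ` {- ja k..jb k - 1}))"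

definition \<mu> ::
  "real \<Rightarrow> (real \<Rightarrow> real) \<Rightarrow> (real \<Rightarrow> real) \<Rightarrow> (real \<Rightarrow> real) \<Rightarrow> (real \<Rightarrow> real) \<Rightarrow>
    (int \<Rightarrow> real) \<Rightarrow> int \<Rightarrow> ennreal" where
  "\<mu> p v w a b x m =
     (\<integral>\<^sup>+t\<in>{x m..x (m + 1)}. ennreal (w t powr p) \<partial>lebesgue) epowr (1 / p) *
     (\<integral>\<^sup>+y\<in>{a (x m)..b (x (m + 1))}. ennreal (v y powr conj_exp p) \<partial>lebesgue)
        epowr (1 / conj_exp p)"

text \<open>\<open>\<gamma>\<close> is admissible as the constant \<open>\<gamma>\<^sub>p\<close> in the upper norm estimate, uniformly in the data.\<close>

definition norm_constant :: "real \<Rightarrow> real \<Rightarrow> bool" where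
  "norm_constant p \<gamma> \<longleftrightarrow> 0 \<le> \<gamma> \<and>
     (\<forall>v w a b \<sigma> x. hs_setting p v w a b \<sigma> \<longrightarrow> partition_points a b \<sigma> x \<longrightarrow>
        op_norm p (hardy_steklov v w a b) \<le> ennreal \<gamma> * (SUP m. \<mu> p v w a b x m))"

end

theory Submission
  imports Defs
begin

text \<open>
  Write \<open>\<H>\<close> for the Hardy--Steklov operator and \<open>I\<^sub>m\<close> for the interval between \<open>x\<^sub>m\<close> and
  \<open>x\<^sub>m\<^sub>+\<^sub>1\<close>.  The estimate comes from one family of finite rank operators, one for every
  threshold \<open>t > 0\<close>.

  On a single interval \<open>I\<^sub>m\<close> the operator is approximated by freezing its boundaries.  Cut
  \<open>I\<^sub>m\<close> into \<open>2N\<close> pieces, and for \<open>s\<close> in the pieces number \<open>2i\<close> and \<open>2i + 1\<close> integrate over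
  the fixed interval from \<open>a z\<^sub>i\<close> to \<open>b z\<^sub>i\<close>, where \<open>z\<^sub>i\<close> is the point between these two pieces.
  This has rank \<open>N\<close>.  On a piece \<open>J\<close> the error involves only the values of \<open>f\<close> on the images
  \<open>a(J)\<close> and \<open>b(J)\<close>, so by Hoelder's inequality it is controlled by the mass of \<open>w\<^sup>p\<close> on \<open>J\<close>
  and the mass of \<open>v\<^sup>p\<^sup>'\<close> on \<open>a(J) \<union> b(J)\<close>.  As \<open>a(I\<^sub>m)\<close> lies to the left of \<open>b(I\<^sub>m)\<close>, a
  weighted mean of these two masses, relative to the two masses in \<open>\<mu>\<^sub>m\<close>, has total at most one
  over \<open>I\<^sub>m\<close>; choosing the pieces so that it is equidistributed makes the error on \<open>I\<^sub>m\<close> at most \<open>\<mu>\<^sub>m / (2N) \<le> \<mu>\<^sub>m / (N + 1)\<close>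
  (\<open>balanced_grid\<close>, \<open>freeze_boundaries\<close>).

  Across different \<open>m\<close> these errors interact very little: the images \<open>a(I\<^sub>m)\<close> are pairwise
  disjoint, and so are the images \<open>b(I\<^sub>m)\<close>.  This would not be so for the full integration
  windows of \<open>\<H>\<close> over \<open>I\<^sub>m\<close>, which all meet within a block.  The intervals that receive no rank
  are therefore treated together: on them the operator is a Hardy--Steklov operator with a
  smaller weight \<open>w\<close> and the same partition points, and the norm estimate with constant \<open>\<gamma>\<close>
  applies (\<open>restricted_weight_norm\<close>).

  Given \<open>t\<close>, spend on \<open>I\<^sub>m\<close> as much rank as there are \<open>j \<ge> 1\<close> with \<open>2\<gamma>\<mu>\<^sub>m / j > t\<close>.  Both
  kinds of intervals then contribute an error of order \<open>t\<close>, provided that \<open>2\<gamma> \<ge> 1\<close>.  This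
  bound on \<open>\<gamma>\<close> holds because the norm estimate is valid for all data: one explicit example
  forces it (\<open>norm_constant_ge_half\<close>).  Hence, if \<open>n\<close> of the numbers \<open>2\<gamma>\<mu>\<^sub>m / j\<close> exceed \<open>t\<close>,
  then \<open>a\<^sub>n\<^sub>+\<^sub>1(\<H>) \<le> 7\<^sup>1\<^sup>/\<^sup>p t\<close> (\<open>approx_number_threshold\<close>).  So the approximation numbers are
  dominated by the decreasing rearrangement of the numbers \<open>7\<^sup>1\<^sup>/\<^sup>p 2\<gamma>\<mu>\<^sub>m / j\<close>, and the same holds
  for the sums of their \<open>\<alpha>\<close>-th powers (\<open>sum_le_sum_by_counting\<close>).  Summing over \<open>j\<close> first
  produces \<open>\<zeta>(\<alpha>)\<close>.
\<close>

section \<open>Norms and masses\<close>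

abbreviation mass :: "real \<Rightarrow> (real \<Rightarrow> real) \<Rightarrow> real set \<Rightarrow> ennreal" where
  "mass r u A \<equiv> (\<integral>\<^sup>+y\<in>A. ennreal (u y powr r) \<partial>lebesgue)"

lemma mass_subset: "A \<subseteq> B \<Longrightarrow> mass r u A \<le> mass r u B"
  by (intro nn_integral_mono) (auto simp: indicator_def)

lemma epowr_mono:
  assumes "0 \<le> r" "x \<le> y"
  shows "x epowr r \<le> y epowr r"
proof (cases "y = top")
  case False
  then have "x \<noteq> top" using assms(2) top_unique by auto
  have "enn2real x \<le> enn2real y"
    using assms(2) False by (simp add: enn2real_mono less_top)
  then show ?thesis
    using False \<open>x \<noteq> top\<close> assms(1) by (auto simp: epowr_def intro!: ennreal_leI powr_mono2)
qed (simp add: epowr_def)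

lemma epowr_ennreal [simp]: "0 \<le> c \<Longrightarrow> ennreal c epowr r = ennreal (c powr r)"
  by (simp add: epowr_def)

lemma epowr_root_le_iff:
  assumes "0 < r" "0 \<le> c"
  shows "x epowr (1 / r) \<le> ennreal c \<longleftrightarrow> x \<le> ennreal (c powr r)"
proof
  assume "x \<le> ennreal (c powr r)"
  from epowr_mono[OF _ this, of "1 / r"] assms show "x epowr (1 / r) \<le> ennreal c"
    by (simp add: powr_powr)
next
  assume L: "x epowr (1 / r) \<le> ennreal c"
  then have "x \<noteq> top" by (auto simp: epowr_def top_unique)
  then obtain t where t: "x = ennreal t" "0 \<le> t" by (cases x) auto
  have "t powr (1 / r) \<le> c" using L t assms by simp
  then have "(t powr (1 / r)) powr r \<le> c powr r" using assms by (intro powr_mono2) auto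
  then show "x \<le> ennreal (c powr r)" using t assms by (simp add: powr_powr ennreal_leI)
qed

lemma Lp_norm_le_iff:
  assumes "0 < p" "0 \<le> c"
  shows "Lp_norm p f \<le> ennreal c \<longleftrightarrow>
    (\<integral>\<^sup>+x. ennreal (\<bar>f x\<bar> powr p) \<partial>half_line) \<le> ennreal (c powr p)"
  using epowr_root_le_iff[OF assms] by (simp add: Lp_norm_def)

lemma Lp_norm_finite_iff:
  "Lp_norm p f < top \<longleftrightarrow> (\<integral>\<^sup>+x. ennreal (\<bar>f x\<bar> powr p) \<partial>half_line) < top"
  by (auto simp: Lp_norm_def epowr_def less_top)

text \<open>The point \<open>0\<close> carries no mass; removing it leaves the set on which \<open>a\<close> and \<open>b\<close> are
  bijections.\<close>
lemma nn_integral_half_line: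
  "(\<integral>\<^sup>+x. F x \<partial>half_line) = (\<integral>\<^sup>+x\<in>{0<..}. F x \<partial>lebesgue)"
proof -
  have "(\<integral>\<^sup>+x. F x \<partial>half_line) = (\<integral>\<^sup>+x\<in>{0..}. F x \<partial>lebesgue)"
    by (rule nn_integral_restrict_space) simp
  also have "\<dots> = (\<integral>\<^sup>+x\<in>{0<..}. F x \<partial>lebesgue)"
  proof (rule nn_integral_cong_AE)
    have "AE x in lebesgue. x \<noteq> (0::real)"
      by (rule AE_I[of _ _ "{0}"]) auto
    then show "AE x in lebesgue. F x * indicator {0..} x = F x * indicator {0<..} x"
      by eventually_elim (auto simp: indicator_def)
  qed
  finally show ?thesis .
qed

lemma borel_measurable_half_lineI: "f \<in> borel_measurable borel \<Longrightarrow> f \<in> borel_measurable half_line"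
  by (intro measurable_restrict_space1 measurable_completion) simp

section \<open>Comparing two sums by counting large terms\<close>

text \<open>The layer cake formula for a single number, infinity included.\<close>
lemma nn_integral_superlevel_indicator:
  "(\<integral>\<^sup>+t. indicator {t. 0 < t \<and> ennreal t < c} t \<partial>lborel) = c"
proof (cases c)
  case (real r)
  then have "{t. 0 < t \<and> ennreal t < c} = {0<..<r}"
    by (auto simp: ennreal_less_iff)
  then show ?thesis using real by simp
next
  case top
  then have "{t. 0 < t \<and> ennreal t < c} = {0<..}" by auto
  moreover have "emeasure lborel {0::real<..} = top"
  proof (rule ccontr)
    assume "emeasure lborel {0::real<..} \<noteq> top"
    then obtain r where r: "emeasure lborel {0::real<..} = ennreal r" "0 \<le> r"
      by (cases "emeasure lborel {0::real<..}") auto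
    have "emeasure lborel {0<..<r+1} \<le> emeasure lborel {0::real<..}"
      by (rule emeasure_mono) auto
    then show False using r by simp
  qed
  ultimately show ?thesis using top by simp
qed

text \<open>
  Both sums are integrals over the level \<open>t\<close> of the number of terms exceeding \<open>t\<close>.  If \<open>N\<close> of
  the \<open>C i\<close> exceed \<open>t\<close>, then by monotonicity \<open>A n \<le> t\<close> for all \<open>n \<ge> N\<close>, so at most \<open>N\<close> of the
  \<open>A n\<close> exceed \<open>t\<close>.  In this form no decreasing rearrangement of \<open>C\<close> has to be constructed.
\<close>
lemma sum_le_sum_by_counting:
  fixes A :: "nat \<Rightarrow> ennreal" and C :: "'i :: countable \<Rightarrow> ennreal"
  assumes "antimono A"
    and count: "\<And>t. 0 < t \<Longrightarrow> finite {i. ennreal t < C i} \<Longrightarrow> A (card {i. ennreal t < C i}) \<le> ennreal t"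
  shows "(\<Sum>n. A n) \<le> (\<integral>\<^sup>+i. C i \<partial>count_space UNIV)"
proof -
  have layers: "(\<integral>\<^sup>+i. D i \<partial>count_space UNIV) =
      (\<integral>\<^sup>+t. (\<integral>\<^sup>+i. indicator {t. 0 < t \<and> ennreal t < D i} t \<partial>count_space UNIV) \<partial>lborel)"
    for D :: "'j :: countable \<Rightarrow> ennreal"
    by (subst nn_integral_count_space_nn_integral)
       (auto intro!: borel_measurable_indicator simp: nn_integral_superlevel_indicator)
  have count_layer: "(\<integral>\<^sup>+i. indicator {t. 0 < t \<and> ennreal t < D i} t \<partial>count_space UNIV) =
      (if 0 < t then emeasure (count_space UNIV) {i. ennreal t < D i} else 0)"
    for D :: "'j :: countable \<Rightarrow> ennreal" and t
  proof -
    have "(\<integral>\<^sup>+i. indicator {t. 0 < t \<and> ennreal t < D i} t \<partial>count_space UNIV) =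
        (\<integral>\<^sup>+i. indicator {i. 0 < t \<and> ennreal t < D i} i \<partial>count_space UNIV)"
      by (intro nn_integral_cong) (auto simp: indicator_def)
    then show ?thesis by (auto simp: nn_integral_indicator)
  qed
  have "(\<Sum>n. A n) = (\<integral>\<^sup>+n. A n \<partial>count_space UNIV)"
    by (simp add: nn_integral_count_space_nat)
  also have "\<dots> \<le> (\<integral>\<^sup>+i. C i \<partial>count_space UNIV)"
    unfolding layers[of A] layers[of C] count_layer
  proof (rule nn_integral_mono)
    fix t :: real
    show "(if 0 < t then emeasure (count_space UNIV) {i. ennreal t < A i} else 0)
      \<le> (if 0 < t then emeasure (count_space UNIV) {i. ennreal t < C i} else 0)"
    proof (cases "0 < t \<and> finite {i. ennreal t < C i}")
      case True
      define N where "N = card {i. ennreal t < C i}"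
      have "{n. ennreal t < A n} \<subseteq> {..<N}"
      proof
        fix n assume "n \<in> {n. ennreal t < A n}"
        then have n: "ennreal t < A n" by simp
        have "\<not> N \<le> n"
        proof
          assume "N \<le> n"
          then have "A n \<le> A N" using \<open>antimono A\<close> by (simp add: antimonoD)
          also have "\<dots> \<le> ennreal t" using count True by (simp add: N_def)
          finally show False using n by simp
        qed
        then show "n \<in> {..<N}" by simp
      qed
      then have "emeasure (count_space UNIV) {n. ennreal t < A n} \<le> emeasure (count_space UNIV) {..<N}"
        by (intro emeasure_mono) auto
      also have "\<dots> = emeasure (count_space UNIV) {i. ennreal t < C i}"
        using True by (simp add: N_def emeasure_count_space)
      finally show ?thesis using True by simp
    next
      case False
      then show ?thesis by (auto simp: emeasure_count_space)
    qed
  qed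
  finally show ?thesis .
qed

text \<open>Unconditional sums of extended non-negative reals are suprema of finite sums, and this is
  all that is needed to pass from an integral over the counting measure to such a sum.\<close>
lemma nn_integral_count_space_int_le_infsum:
  fixes f :: "int \<Rightarrow> ennreal"
  shows "(\<integral>\<^sup>+m. f m \<partial>count_space UNIV) \<le> (\<Sum>\<^sub>\<infinity>m\<in>UNIV. f m)"
proof -
  have "(\<integral>\<^sup>+m. f m \<partial>count_space UNIV) = (\<integral>\<^sup>+n. f (int_decode n) \<partial>count_space UNIV)"
    by (rule nn_integral_bij_count_space[symmetric]) (rule bij_int_decode)
  also have "\<dots> = (\<Sum>n. f (int_decode n))" by (rule nn_integral_count_space_nat)
  also have "\<dots> = (SUP n. \<Sum>i<n. f (int_decode i))" by (rule suminf_eq_SUP)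
  also have "\<dots> \<le> (\<Sum>\<^sub>\<infinity>m\<in>UNIV. f m)"
  proof (rule SUP_least)
    fix n
    have "(\<Sum>i<n. f (int_decode i)) = sum f (int_decode ` {..<n})"
      by (subst sum.reindex) (auto intro: inj_on_subset[OF inj_int_decode])
    also have "\<dots> \<le> (\<Sum>\<^sub>\<infinity>m\<in>UNIV. f m)"
      by (subst nonneg_infsum_complete) (auto intro!: SUP_upper)
    finally show "(\<Sum>i<n. f (int_decode i)) \<le> (\<Sum>\<^sub>\<infinity>m\<in>UNIV. f m)" .
  qed
  finally show ?thesis .
qed

section \<open>Hoelder's inequality and differences of integrals\<close>

text \<open>
  Young's inequality for the two functions divided by their norms.  Bounds \<open>X\<close>, \<open>Y\<close> for the
  integrals replace the integrals themselves, so that the conclusion is about real numbers; if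
  one of the bounds vanishes, so does the product, almost everywhere.
\<close>
lemma Hoelder_nn_integral:
  fixes f g :: "'a \<Rightarrow> real"
  assumes [measurable]: "f \<in> borel_measurable M" "g \<in> borel_measurable M"
    and pq: "1 < p" "1 < q" "1 / p + 1 / q = 1"
    and X: "(\<integral>\<^sup>+x. ennreal (\<bar>f x\<bar> powr p) \<partial>M) \<le> ennreal X" "0 \<le> X"
    and Y: "(\<integral>\<^sup>+x. ennreal (\<bar>g x\<bar> powr q) \<partial>M) \<le> ennreal Y" "0 \<le> Y"
  shows "(\<integral>\<^sup>+x. ennreal \<bar>f x * g x\<bar> \<partial>M) \<le> ennreal (X powr (1 / p) * Y powr (1 / q))"
proof -
  have null: "AE x in M. h x = 0"
    if "h \<in> borel_measurable M" "(\<integral>\<^sup>+x. ennreal (\<bar>h x\<bar> powr r) \<partial>M) \<le> ennreal 0" for h :: "'a \<Rightarrow> real" and r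
  proof -
    have [measurable]: "h \<in> borel_measurable M" by fact
    have "(\<integral>\<^sup>+x. ennreal (\<bar>h x\<bar> powr r) \<partial>M) = 0" using that(2) by simp
    then have "AE x in M. ennreal (\<bar>h x\<bar> powr r) = 0"
      by (subst (asm) nn_integral_0_iff_AE) auto
    then show ?thesis by eventually_elim simp
  qed
  show ?thesis
  proof (cases "X = 0 \<or> Y = 0")
    case True
    then have "AE x in M. f x * g x = 0"
    proof
      assume "X = 0"
      then have "AE x in M. f x = 0" using X null[of f p] by auto
      then show ?thesis by eventually_elim simp
    next
      assume "Y = 0"
      then have "AE x in M. g x = 0" using Y null[of g q] by auto
      then show ?thesis by eventually_elim simp
    qed
    then have "(\<integral>\<^sup>+x. ennreal \<bar>f x * g x\<bar> \<partial>M) = 0"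
      by (subst nn_integral_0_iff_AE) auto
    then show ?thesis by simp
  next
    case False
    then have pos: "0 < X" "0 < Y" using X Y by auto
    define c where "c = X powr (1 / p) * Y powr (1 / q)"
    have "0 < c" using pos by (simp add: c_def)
    have "ennreal \<bar>f x * g x\<bar> \<le> ennreal (c / (p * X)) * ennreal (\<bar>f x\<bar> powr p)
        + ennreal (c / (q * Y)) * ennreal (\<bar>g x\<bar> powr q)" for x
    proof -
      have "(\<bar>f x\<bar> / X powr (1 / p)) * (\<bar>g x\<bar> / Y powr (1 / q)) \<le>
          (\<bar>f x\<bar> / X powr (1 / p)) powr p / p + (\<bar>g x\<bar> / Y powr (1 / q)) powr q / q"
        by (rule Youngs_inequality) (use pq in auto)
      also have "(\<bar>f x\<bar> / X powr (1 / p)) powr p = \<bar>f x\<bar> powr p / X"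
        using pos pq by (simp add: powr_divide powr_powr)
      also have "(\<bar>g x\<bar> / Y powr (1 / q)) powr q = \<bar>g x\<bar> powr q / Y"
        using pos pq by (simp add: powr_divide powr_powr)
      finally have "\<bar>f x\<bar> * \<bar>g x\<bar> / c \<le> \<bar>f x\<bar> powr p / X / p + \<bar>g x\<bar> powr q / Y / q"
        by (simp add: c_def)
      then have "\<bar>f x * g x\<bar> \<le> c * (\<bar>f x\<bar> powr p / X / p + \<bar>g x\<bar> powr q / Y / q)"
        using \<open>0 < c\<close> by (simp add: abs_mult divide_le_eq mult.commute)
      also have "\<dots> = (c / (p * X)) * (\<bar>f x\<bar> powr p) + (c / (q * Y)) * (\<bar>g x\<bar> powr q)"
        by (simp add: field_simps)
      finally show ?thesis
        using \<open>0 < c\<close> pos pq by (simp flip: ennreal_mult ennreal_plus add: ennreal_leI)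
    qed
    then have "(\<integral>\<^sup>+x. ennreal \<bar>f x * g x\<bar> \<partial>M) \<le>
        (\<integral>\<^sup>+x. ennreal (c / (p * X)) * ennreal (\<bar>f x\<bar> powr p)
          + ennreal (c / (q * Y)) * ennreal (\<bar>g x\<bar> powr q) \<partial>M)"
      by (intro nn_integral_mono)
    also have "\<dots> = ennreal (c / (p * X)) * (\<integral>\<^sup>+x. ennreal (\<bar>f x\<bar> powr p) \<partial>M)
          + ennreal (c / (q * Y)) * (\<integral>\<^sup>+x. ennreal (\<bar>g x\<bar> powr q) \<partial>M)"
      by (simp add: nn_integral_add nn_integral_cmult)
    also have "\<dots> \<le> ennreal (c / (p * X)) * ennreal X + ennreal (c / (q * Y)) * ennreal Y"
      by (intro add_mono mult_left_mono X Y) auto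
    also have "\<dots> = ennreal (c / (p * X) * X + c / (q * Y) * Y)"
      using \<open>0 < c\<close> pos pq by (simp flip: ennreal_mult)
    also have "c / (p * X) * X + c / (q * Y) * Y = c * (1 / p + 1 / q)"
      using pos by (simp add: field_simps)
    finally show ?thesis by (simp add: pq c_def)
  qed
qed
lemma Hoelder_on_set:
  fixes f v :: "real \<Rightarrow> real"
  assumes pq: "1 < p" "1 < q" "1 / p + 1 / q = 1"
    and f: "f \<in> borel_measurable lebesgue" and v: "v \<in> borel_measurable lebesgue" "\<And>y. 0 \<le> v y"
    and A: "A \<in> sets lebesgue"
    and X: "mass p (\<lambda>y. \<bar>f y\<bar>) A \<le> ennreal X" "0 \<le> X"
    and Y: "mass q v A \<le> ennreal Y" "0 \<le> Y"
  shows "(\<integral>\<^sup>+y\<in>A. ennreal \<bar>f y * v y\<bar> \<partial>lebesgue) \<le> ennreal (X powr (1 / p) * Y powr (1 / q))"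
proof -
  have "(\<integral>\<^sup>+y. ennreal \<bar>(indicator A y * f y) * (indicator A y * v y)\<bar> \<partial>lebesgue)
      \<le> ennreal (X powr (1 / p) * Y powr (1 / q))"
  proof (rule Hoelder_nn_integral[OF _ _ pq _ X(2) _ Y(2)])
    have "(\<integral>\<^sup>+y. ennreal (\<bar>indicator A y * f y\<bar> powr p) \<partial>lebesgue) = mass p (\<lambda>y. \<bar>f y\<bar>) A"
      by (intro nn_integral_cong) (auto simp: indicator_def)
    then show "(\<integral>\<^sup>+y. ennreal (\<bar>indicator A y * f y\<bar> powr p) \<partial>lebesgue) \<le> ennreal X" using X by simp
    have "(\<integral>\<^sup>+y. ennreal (\<bar>indicator A y * v y\<bar> powr q) \<partial>lebesgue) = mass q v A"
      using v(2) by (intro nn_integral_cong) (auto simp: indicator_def)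
    then show "(\<integral>\<^sup>+y. ennreal (\<bar>indicator A y * v y\<bar> powr q) \<partial>lebesgue) \<le> ennreal Y" using Y by simp
  qed (intro borel_measurable_times borel_measurable_indicator A f v)+
  also have "(\<integral>\<^sup>+y. ennreal \<bar>(indicator A y * f y) * (indicator A y * v y)\<bar> \<partial>lebesgue)
      = (\<integral>\<^sup>+y\<in>A. ennreal \<bar>f y * v y\<bar> \<partial>lebesgue)"
    by (intro nn_integral_cong) (auto simp: indicator_def)
  finally show ?thesis .
qed

lemma Hoelder_set_integrable:
  fixes f v :: "real \<Rightarrow> real"
  assumes pq: "1 < p" "1 < q" "1 / p + 1 / q = 1"
    and f: "f \<in> borel_measurable lebesgue" and v: "v \<in> borel_measurable lebesgue" "\<And>y. 0 \<le> v y"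
    and A: "A \<in> sets lebesgue"
    and X: "mass p (\<lambda>y. \<bar>f y\<bar>) A < top" and Y: "mass q v A < top"
  shows "set_integrable lebesgue A (\<lambda>y. f y * v y)"
  unfolding set_integrable_def
proof (rule integrableI_bounded)
  show "(\<lambda>y. indicator A y *\<^sub>R (f y * v y)) \<in> borel_measurable lebesgue"
    by (intro borel_measurable_scaleR borel_measurable_indicator borel_measurable_times A f v)
  obtain X' where X': "mass p (\<lambda>y. \<bar>f y\<bar>) A = ennreal X'" "0 \<le> X'"
    using X by (cases "mass p (\<lambda>y. \<bar>f y\<bar>) A") auto
  obtain Y' where Y': "mass q v A = ennreal Y'" "0 \<le> Y'"
    using Y by (cases "mass q v A") auto
  have "(\<integral>\<^sup>+y. ennreal (norm (indicator A y *\<^sub>R (f y * v y))) \<partial>lebesgue)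
      = (\<integral>\<^sup>+y\<in>A. ennreal \<bar>f y * v y\<bar> \<partial>lebesgue)"
    by (intro nn_integral_cong) (auto simp: indicator_def)
  also have "\<dots> \<le> ennreal (X' powr (1 / p) * Y' powr (1 / q))"
    by (rule Hoelder_on_set[OF pq f v A]) (use X' Y' in auto)
  also have "\<dots> < \<infinity>" by simp
  finally show "(\<integral>\<^sup>+y. ennreal (norm (indicator A y *\<^sub>R (f y * v y))) \<partial>lebesgue) < \<infinity>" .
qed

text \<open>Compares the integration window of the operator at a point with a frozen one.\<close>
lemma set_integral_symmetric_difference:
  fixes h :: "real \<Rightarrow> real"
  assumes "set_integrable lebesgue A h" "set_integrable lebesgue B h"
    and "A - B \<subseteq> E" "B - A \<subseteq> E"
  shows "ennreal \<bar>(LINT y:A|lebesgue. h y) - (LINT y:B|lebesgue. h y)\<bar>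
    \<le> (\<integral>\<^sup>+y\<in>E. ennreal \<bar>h y\<bar> \<partial>lebesgue)"
proof -
  have "(LINT y:A|lebesgue. h y) - (LINT y:B|lebesgue. h y) =
      (LINT y|lebesgue. indicator A y *\<^sub>R h y - indicator B y *\<^sub>R h y)"
    using assms(1,2) unfolding set_integrable_def set_lebesgue_integral_def by simp
  then have "ennreal \<bar>(LINT y:A|lebesgue. h y) - (LINT y:B|lebesgue. h y)\<bar> \<le>
      (\<integral>\<^sup>+y. ennreal (norm (indicator A y *\<^sub>R h y - indicator B y *\<^sub>R h y)) \<partial>lebesgue)"
    using integral_norm_bound_ennreal[of lebesgue "\<lambda>y. indicator A y *\<^sub>R h y - indicator B y *\<^sub>R h y"] assms(1,2)
    unfolding set_integrable_def by simp
  also have "\<dots> \<le> (\<integral>\<^sup>+y\<in>E. ennreal \<bar>h y\<bar> \<partial>lebesgue)"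
    using assms(3,4) by (intro nn_integral_mono) (auto simp: indicator_def)
  finally show ?thesis .
qed

section \<open>Freezing the boundaries on one interval\<close>

lemma equidistributing_grid:
  fixes L :: "real \<Rightarrow> real"
  assumes "s \<le> t" "continuous_on {s..t} L" "L t - L s \<le> 1" "0 < n"
    and mono: "\<And>x y. s \<le> x \<Longrightarrow> x \<le> y \<Longrightarrow> y \<le> t \<Longrightarrow> L x \<le> L y"
  obtains g :: "nat \<Rightarrow> real" where "g 0 = s" "g n = t"
    "\<And>i j. i \<le> j \<Longrightarrow> j \<le> n \<Longrightarrow> g i \<le> g j" "\<And>i. i \<le> n \<Longrightarrow> g i \<in> {s..t}"
    "\<And>i. i < n \<Longrightarrow> L (g (Suc i)) - L (g i) \<le> 1 / n"
proof (cases "L s = L t")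
  case True
  define g :: "nat \<Rightarrow> real" where "g i = (if i = 0 then s else t)" for i
  show ?thesis
    by (rule that[of g]) (use assms True in \<open>auto simp: g_def\<close>)
next
  case False
  then have "L s < L t" using mono[of s t] assms(1) by simp
  \<comment> \<open>If \<open>L\<close> is not constant, points where it takes equally spaced values are
      automatically ordered; \<open>L\<close> itself need not be injective.\<close>
  define d where "d = (L t - L s) / n"
  have "0 < d" using \<open>L s < L t\<close> \<open>0 < n\<close> by (simp add: d_def)
  have "d \<le> 1 / n" using assms(3) by (simp add: d_def divide_right_mono)
  have "n * d = L t - L s" using \<open>0 < n\<close> by (simp add: d_def)
  have "\<exists>x. s \<le> x \<and> x \<le> t \<and> L x = L s + i * d" if "i \<le> n" for i :: nat
  proof (rule IVT')
    have "i * d \<le> n * d" using that \<open>0 < d\<close> by (intro mult_right_mono) auto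
    then show "L s + i * d \<le> L t" using \<open>n * d = L t - L s\<close> by simp
  qed (use assms \<open>0 < d\<close> in auto)
  then obtain y where y: "\<And>i. i \<le> n \<Longrightarrow> s \<le> y i \<and> y i \<le> t \<and> L (y i) = L s + i * d" by metis
  define g where "g i = (if i = 0 then s else if i = n then t else y i)" for i
  have gm: "g i \<in> {s..t}" if "i \<le> n" for i using y[OF that] assms(1) by (auto simp: g_def)
  have gL: "L (g i) = L s + i * d" if "i \<le> n" for i
    using y[OF that] \<open>n * d = L t - L s\<close> by (auto simp: g_def)
  show ?thesis
  proof (rule that[of g])
    fix i j assume ij: "i \<le> j" "j \<le> n"
    show "g i \<le> g j"
    proof (rule ccontr)
      assume "\<not> g i \<le> g j"
      then have "L (g j) \<le> L (g i)" using gm[of i] gm[of j] ij by (intro mono) auto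
      then have "j * d \<le> i * d" using gL[of i] gL[of j] ij by simp
      then have "i = j" using \<open>0 < d\<close> ij by simp
      then show False using \<open>\<not> g i \<le> g j\<close> by simp
    qed
  next
    fix i assume "i < n"
    then show "L (g (Suc i)) - L (g i) \<le> 1 / n"
      using gL[of i] gL[of "Suc i"] \<open>d \<le> 1 / n\<close> by (simp add: algebra_simps)
  qed (use gm \<open>0 < n\<close> in \<open>auto simp: g_def\<close>)
qed

lemma sum_indicator_grid:
  fixes g :: "nat \<Rightarrow> real"
  assumes "\<And>i j. i \<le> j \<Longrightarrow> j \<le> n \<Longrightarrow> g i \<le> g j"
  shows "(\<Sum>i<n. indicator {g i<..g (Suc i)} x :: ennreal) = indicator {g 0<..g n} x"
  using assms
proof (induction n)
  case (Suc n)
  have "(\<Sum>i<n. indicator {g i<..g (Suc i)} x :: ennreal) = indicator {g 0<..g n} x"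
    by (rule Suc.IH) (use Suc.prems in auto)
  moreover have "g 0 \<le> g n" "g n \<le> g (Suc n)" using Suc.prems by auto
  ultimately show ?case by (auto simp: indicator_def)
qed simp

text \<open>Through the gauge integral, half-open masses become increments of a primitive, which is
  continuous and hence accessible to the intermediate value theorem.\<close>
lemma nonneg_integral_increment:
  fixes u :: "real \<Rightarrow> real"
  assumes [measurable]: "u \<in> borel_measurable lebesgue" and "\<And>x. 0 \<le> u x"
    and fin: "(\<integral>\<^sup>+x\<in>{l..r}. ennreal (u x) \<partial>lebesgue) < top"
  shows "u integrable_on {l..r}"
    and "\<And>x y. l \<le> x \<Longrightarrow> x \<le> y \<Longrightarrow> y \<le> r \<Longrightarrow>
      (\<integral>\<^sup>+t\<in>{x<..y}. ennreal (u t) \<partial>lebesgue) = ennreal (integral {l..y} u - integral {l..x} u)"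
    and "\<And>x y. l \<le> x \<Longrightarrow> x \<le> y \<Longrightarrow> y \<le> r \<Longrightarrow> integral {l..x} u \<le> integral {l..y} u"
proof -
  have "(\<integral>\<^sup>+x. ennreal (norm (indicator {l..r} x *\<^sub>R u x)) \<partial>lebesgue)
      = (\<integral>\<^sup>+x\<in>{l..r}. ennreal (u x) \<partial>lebesgue)"
    using assms(2) by (intro nn_integral_cong) (auto simp: indicator_def)
  then have "set_integrable lebesgue {l..r} u"
    unfolding set_integrable_def using fin
    by (intro integrableI_bounded borel_measurable_scaleR borel_measurable_indicator assms) auto
  then show int: "u integrable_on {l..r}" by (rule set_lebesgue_integral_eq_integral(1))
  fix x y assume xy: "l \<le> x" "x \<le> y" "y \<le> r"
  have "u integrable_on {l..y}" "u integrable_on {x..y}"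
    using xy by (auto intro!: integrable_on_subinterval[OF int])
  then have I: "integral {l..x} u + integral {x..y} u = integral {l..y} u"
    using xy by (intro Henstock_Kurzweil_Integration.integral_combine) auto
  have "integral {x..y} u \<ge> 0" using assms(2) \<open>u integrable_on {x..y}\<close> by (intro integral_nonneg) auto
  then show "integral {l..x} u \<le> integral {l..y} u" using I by simp
  have "(\<integral>\<^sup>+t\<in>{x<..y}. ennreal (u t) \<partial>lebesgue) = (\<integral>\<^sup>+t\<in>{x..y}. ennreal (u t) \<partial>lebesgue)"
  proof (rule nn_integral_cong_AE)
    have "AE t in lebesgue. t \<noteq> x" by (rule AE_I[of _ _ "{x}"]) auto
    then show "AE t in lebesgue. ennreal (u t) * indicator {x<..y} t = ennreal (u t) * indicator {x..y} t"
      by eventually_elim (auto simp: indicator_def)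
  qed
  also have "\<dots> = (\<integral>\<^sup>+t\<in>{x..y}. ennreal (u t) \<partial>lborel)"
    by (rule nn_integral_completion)
  also have "\<dots> = ennreal (integral {x..y} u)"
    by (rule nn_integral_has_integral_lebesgue')
       (use assms(2) \<open>u integrable_on {x..y}\<close> in \<open>auto simp: integrable_integral\<close>)
  also have "integral {x..y} u = integral {l..y} u - integral {l..x} u" using I by simp
  finally show "(\<integral>\<^sup>+t\<in>{x<..y}. ennreal (u t) \<partial>lebesgue) = ennreal (integral {l..y} u - integral {l..x} u)" .
qed

text \<open>
  The grid equidistributes
  \<open>L(x) = (1/p) W(x)/W + (1/q) V(x)/V\<close>,
  where \<open>W(x)\<close> is the mass of \<open>w\<^sup>p\<close> on \<open>[s, x]\<close> and \<open>V(x)\<close> the mass of \<open>v\<^sup>q\<close> swept by the two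
  boundaries while the variable moves from \<open>s\<close> to \<open>x\<close>.  As \<open>a t \<le> b s\<close>, the two boundaries
  sweep non-overlapping parts of \<open>[a s, b t]\<close>, so the total increment of \<open>L\<close> is at most
  \<open>1/p + 1/q = 1\<close>.  By Young's inequality the product of the normalised masses of a piece is
  at most the increment of \<open>L\<close> over it.
\<close>
lemma balanced_grid:
  fixes w v a b :: "real \<Rightarrow> real"
  assumes pq: "1 < p" "1 < q" "1 / p + 1 / q = 1"
    and [measurable]: "w \<in> borel_measurable lebesgue" "v \<in> borel_measurable lebesgue"
    and st: "s \<le> t"
    and cont: "continuous_on {s..t} a" "continuous_on {s..t} b"
    and mono: "mono_on {s..t} a" "mono_on {s..t} b"
    and ab: "a t \<le> b s"
    and W: "mass p w {s..t} = ennreal W" "0 \<le> W"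
    and V: "mass q v {a s..b t} = ennreal V" "0 \<le> V"
    and n: "0 < n"
  obtains g Wg Vg where "g 0 = s" "g n = t"
    "\<And>i j. i \<le> j \<Longrightarrow> j \<le> n \<Longrightarrow> g i \<le> g j" "\<And>i. i \<le> n \<Longrightarrow> g i \<in> {s..t}"
    "\<And>i. i < n \<Longrightarrow> mass p w {g i<..g (Suc i)} = ennreal (Wg i)"
    "\<And>i. i < n \<Longrightarrow> mass q v {a (g i)<..a (g (Suc i))} + mass q v {b (g i)<..b (g (Suc i))} = ennreal (Vg i)"
    "\<And>i. i < n \<Longrightarrow> 0 \<le> Wg i" "\<And>i. i < n \<Longrightarrow> 0 \<le> Vg i"
    "\<And>i. i < n \<Longrightarrow> Wg i powr (1 / p) * Vg i powr (1 / q) \<le> W powr (1 / p) * V powr (1 / q) / n"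
proof -
  define Fw where "Fw x = integral {s..x} (\<lambda>y. w y powr p)" for x
  define Fv where "Fv x = integral {a s..x} (\<lambda>y. v y powr q)" for x
  have a_le: "a s \<le> a x" "a x \<le> a y" "a y \<le> a t" and b_le: "b s \<le> b x" "b x \<le> b y" "b y \<le> b t"
    if "s \<le> x" "x \<le> y" "y \<le> t" for x y
    using that mono by (auto simp: mono_on_def)
  have W_fin: "mass p w {s..t} < top" and V_fin: "mass q v {a s..b t} < top"
    using W V by simp_all
  note w_inc = nonneg_integral_increment[OF _ _ W_fin, folded Fw_def]
  note v_inc = nonneg_integral_increment[OF _ _ V_fin, folded Fv_def]
  have Fw_mass: "mass p w {x<..y} = ennreal (Fw y - Fw x)" "Fw x \<le> Fw y"
    if "s \<le> x" "x \<le> y" "y \<le> t" for x y using w_inc(2,3)[of x y] that by auto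
  have Fv_mass: "mass q v {x<..y} = ennreal (Fv y - Fv x)" "Fv x \<le> Fv y"
    if "a s \<le> x" "x \<le> y" "y \<le> b t" for x y using v_inc(2,3)[of x y] that by auto
  have contFw: "continuous_on {s..t} Fw"
    unfolding Fw_def by (intro indefinite_integral_continuous_1 w_inc(1)) auto
  have contFv: "continuous_on {a s..b t} Fv"
    unfolding Fv_def by (intro indefinite_integral_continuous_1 v_inc(1)) auto
  have ab_range: "a x \<in> {a s..b t}" "b x \<in> {a s..b t}" if "x \<in> {s..t}" for x
    using that a_le[of x x] b_le[of x x] ab by auto
  have total: "Fw t - Fw s \<le> W" "(Fv (a t) - Fv (a s)) + (Fv (b t) - Fv (b s)) \<le> V"
  proof -
    have "mass p w {s<..t} \<le> mass p w {s..t}"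
      by (intro nn_integral_mono) (auto simp: indicator_def)
    then show "Fw t - Fw s \<le> W" using Fw_mass[of s t] W st by simp
    have "mass q v {a s<..b t} \<le> mass q v {a s..b t}"
      by (intro nn_integral_mono) (auto simp: indicator_def)
    moreover have "a s \<le> b t" using ab_range(2)[of t] st by simp
    ultimately have "Fv (b t) - Fv (a s) \<le> V" using Fv_mass[of "a s" "b t"] V st by simp
    moreover have "Fv (a t) \<le> Fv (b s)"
      using Fv_mass(2)[of "a t" "b s"] ab a_le[of s t] b_le[of s t] st by simp
    ultimately show "(Fv (a t) - Fv (a s)) + (Fv (b t) - Fv (b s)) \<le> V" by simp
  qed
  \<comment> \<open>If \<open>W = 0\<close> or \<open>V = 0\<close>, division by zero makes the corresponding summand vanish, which is
    harmless: the product to be bounded is zero in that case.\<close>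
  define L where "L x = Fw x / (p * W) + (Fv (a x) + Fv (b x)) / (q * V)" for x
  have L_inc: "L y - L x = (Fw y - Fw x) / (p * W) +
      ((Fv (a y) - Fv (a x)) + (Fv (b y) - Fv (b x))) / (q * V)" for x y
    by (simp add: L_def diff_divide_distrib add_divide_distrib)
  have Fva: "Fv (a x) \<le> Fv (a y)" and Fvb: "Fv (b x) \<le> Fv (b y)"
    if "s \<le> x" "x \<le> y" "y \<le> t" for x y
    using that a_le[of x y] b_le[of x y] ab_range[of x] ab_range[of y] by (auto intro!: Fv_mass)
  have share: "d / (r * X) \<le> 1 / r" if "d \<le> X" "0 \<le> X" "0 < r" for d X r :: real
  proof -
    have "d / (r * X) \<le> X / (r * X)" using that by (intro divide_right_mono) auto
    also have "\<dots> \<le> 1 / r" using that by (cases "X = 0") auto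
    finally show ?thesis .
  qed
  have "L t - L s \<le> 1 / p + 1 / q"
    unfolding L_inc
  proof (rule add_mono)
    show "(Fw t - Fw s) / (p * W) \<le> 1 / p"
      using total W pq by (intro share) auto
    show "((Fv (a t) - Fv (a s)) + (Fv (b t) - Fv (b s))) / (q * V) \<le> 1 / q"
      using total V pq by (intro share) auto
  qed
  then have L1: "L t - L s \<le> 1" using pq by simp
  have contL: "continuous_on {s..t} L"
    unfolding L_def divide_inverse
    by (intro continuous_intros contFw continuous_on_compose2[OF contFv] cont) (use ab_range in auto)
  have monoL: "L x \<le> L y" if "s \<le> x" "x \<le> y" "y \<le> t" for x y
  proof -
    have "0 \<le> L y - L x"
      unfolding L_inc using Fw_mass(2)[OF that] Fva[OF that] Fvb[OF that] W V pq
      by (intro add_nonneg_nonneg divide_nonneg_nonneg) auto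
    then show ?thesis by simp
  qed
  obtain g where g: "g 0 = s" "g n = t"
    "\<And>i j. i \<le> j \<Longrightarrow> j \<le> n \<Longrightarrow> g i \<le> g j" "\<And>i. i \<le> n \<Longrightarrow> g i \<in> {s..t}"
    "\<And>i. i < n \<Longrightarrow> L (g (Suc i)) - L (g i) \<le> 1 / n"
    by (rule equidistributing_grid[OF st contL L1 n], erule (2) monoL, blast)
  define Wg where "Wg i = Fw (g (Suc i)) - Fw (g i)" for i
  define Vg where "Vg i = (Fv (a (g (Suc i))) - Fv (a (g i))) + (Fv (b (g (Suc i))) - Fv (b (g i)))" for i
  have step: "s \<le> g i" "g i \<le> g (Suc i)" "g (Suc i) \<le> t" if "i < n" for i
    using g(3)[of i "Suc i"] g(4)[of i] g(4)[of "Suc i"] that by auto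
  show ?thesis
  proof (rule that[of g Wg Vg])
    fix i assume i: "i < n"
    note st_i = step[OF i]
    show "mass p w {g i<..g (Suc i)} = ennreal (Wg i)"
      using Fw_mass(1)[OF st_i] by (simp add: Wg_def)
    have "mass q v {a (g i)<..a (g (Suc i))} = ennreal (Fv (a (g (Suc i))) - Fv (a (g i)))"
         "mass q v {b (g i)<..b (g (Suc i))} = ennreal (Fv (b (g (Suc i))) - Fv (b (g i)))"
      using st_i a_le[OF st_i] b_le[OF st_i] ab_range[of "g i"] ab_range[of "g (Suc i)"]
      by (auto intro!: Fv_mass(1))
    then show "mass q v {a (g i)<..a (g (Suc i))} + mass q v {b (g i)<..b (g (Suc i))} = ennreal (Vg i)"
      using Fva[OF st_i] Fvb[OF st_i] by (simp add: Vg_def)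
    show W0: "0 \<le> Wg i" using Fw_mass(2)[OF st_i] by (simp add: Wg_def)
    show V0: "0 \<le> Vg i" using Fva[OF st_i] Fvb[OF st_i] by (simp add: Vg_def)
    show "Wg i powr (1 / p) * Vg i powr (1 / q) \<le> W powr (1 / p) * V powr (1 / q) / n"
    proof (cases "W = 0 \<or> V = 0")
      case True
      have "Wg i \<le> W"
        using total(1) Fw_mass(2)[of s "g i"] Fw_mass(2)[of "g (Suc i)" t] st_i by (simp add: Wg_def)
      moreover have "Vg i \<le> V"
        using total(2) Fva[of s "g i"] Fva[of "g (Suc i)" t] Fvb[of s "g i"] Fvb[of "g (Suc i)" t] st_i
        by (simp add: Vg_def)
      ultimately have "Wg i = 0 \<or> Vg i = 0" using True W0 V0 by auto
      then show ?thesis by auto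
    next
      case False
      then have pos: "0 < W" "0 < V" using W V by auto
      have "(Wg i / W) powr (1 / p) * (Vg i / V) powr (1 / q)
          \<le> ((Wg i / W) powr (1 / p)) powr p / p + ((Vg i / V) powr (1 / q)) powr q / q"
        by (rule Youngs_inequality) (use pq in auto)
      also have "\<dots> = Wg i / (p * W) + Vg i / (q * V)"
        using pos pq W0 V0 by (simp add: powr_powr field_simps)
      also have "\<dots> = L (g (Suc i)) - L (g i)" by (simp add: L_inc Wg_def Vg_def)
      also have "\<dots> \<le> 1 / n" by (rule g(5)) fact
      finally show ?thesis using pos W0 V0 by (simp add: powr_divide field_simps)
    qed
  qed (use g in auto)
qed
text \<open>
  Freezing at every second grid point makes one constant window serve two neighbouring pieces,
  and this is where the factor \<open>2\<close> in \<open>2 * N\<close> comes from.  For \<open>s\<close> in a piece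
  \<open>J = {g k<..g (Suc k)}\<close> the frozen point is an endpoint of \<open>J\<close>, so the true and the frozen
  window differ only inside \<open>a(J) \<union> b(J)\<close>.  These sets are disjoint for different pieces, hence
  the local errors add up without loss.
\<close>
lemma freeze_boundaries:
  fixes w v a b :: "real \<Rightarrow> real" and N :: nat
  assumes pq: "1 < p" "1 < q" "1 / p + 1 / q = 1"
    and w: "w \<in> borel_measurable lebesgue" "\<And>x. 0 \<le> w x"
    and v: "v \<in> borel_measurable lebesgue" "\<And>x. 0 \<le> v x"
    and st: "s \<le> t"
    and cont: "continuous_on {s..t} a" "continuous_on {s..t} b"
    and smono: "strict_mono_on {s..t} a" "strict_mono_on {s..t} b"
    and ab: "a t \<le> b s"
    and W: "mass p w {s..t} = ennreal W" "0 \<le> W"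
    and V: "mass q v {a s..b t} = ennreal V" "0 \<le> V"
    and N: "0 < N"
  obtains P :: "nat \<Rightarrow> real set" and z :: "nat \<Rightarrow> real"
  where "\<And>i. i < N \<Longrightarrow> P i \<in> sets borel" "\<And>i. i < N \<Longrightarrow> P i \<subseteq> {s<..t}"
    "\<And>i. i < N \<Longrightarrow> z i \<in> {s..t}"
    "\<And>f. f \<in> borel_measurable lebesgue \<Longrightarrow> mass p (\<lambda>y. \<bar>f y\<bar>) UNIV < top \<Longrightarrow>
      mass p (\<lambda>x. \<bar>w x * (LINT y:{a x..b x}|lebesgue. f y * v y)
          - (\<Sum>i<N. (indicator (P i) x * w x) * (LINT y:{a (z i)<..b (z i)}|lebesgue. f y * v y))\<bar>) {s<..t}
      \<le> ennreal ((W powr (1 / p) * V powr (1 / q) / (2 * N)) powr p)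
          * (mass p (\<lambda>y. \<bar>f y\<bar>) {a s<..a t} + mass p (\<lambda>y. \<bar>f y\<bar>) {b s<..b t})"
proof -
  have mono: "mono_on {s..t} a" "mono_on {s..t} b"
    using smono by (simp_all add: strict_mono_on_imp_mono_on)
  define \<epsilon> where "\<epsilon> = W powr (1 / p) * V powr (1 / q) / (2 * N)"
  have "0 < 2 * N" using N by simp
  obtain g Wg Vg where g0: "g 0 = s" and gn: "g (2 * N) = t"
    and g_mono: "\<And>i j. i \<le> j \<Longrightarrow> j \<le> 2 * N \<Longrightarrow> g i \<le> g j"
    and g_mem: "\<And>i. i \<le> 2 * N \<Longrightarrow> g i \<in> {s..t}"
    and Wg: "\<And>i. i < 2 * N \<Longrightarrow> mass p w {g i<..g (Suc i)} = ennreal (Wg i)"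
    and Vg: "\<And>i. i < 2 * N \<Longrightarrow>
        mass q v {a (g i)<..a (g (Suc i))} + mass q v {b (g i)<..b (g (Suc i))} = ennreal (Vg i)"
    and Wg0: "\<And>i. i < 2 * N \<Longrightarrow> 0 \<le> Wg i" and Vg0: "\<And>i. i < 2 * N \<Longrightarrow> 0 \<le> Vg i"
    and small: "\<And>i. i < 2 * N \<Longrightarrow> Wg i powr (1 / p) * Vg i powr (1 / q) \<le> \<epsilon>"
    unfolding \<epsilon>_def
    by (rule balanced_grid[OF pq w(1) v(1) st cont mono ab W V \<open>0 < 2 * N\<close>]) auto
  define P where "P i = {g (2 * i)<..g (2 * i + 2)}" for i
  define z where "z i = g (2 * i + 1)" for i
  \<comment> \<open>the number of the window that serves the \<open>k\<close>-th piece\<close>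
  define c where "c k = k div 2" for k :: nat
  have z_c: "z (c k) = g k \<or> z (c k) = g (Suc k)" for k
  proof (cases "even k")
    case True
    then show ?thesis by (auto simp: z_def c_def)
  next
    case False
    then have "2 * (k div 2) + 1 = k" by presburger
    then show ?thesis by (simp add: z_def c_def)
  qed
  have P_c: "x \<in> P i \<longleftrightarrow> i = c k" if "x \<in> {g k<..g (Suc k)}" "k < 2 * N" "i < N" for x k i
  proof
    assume "i = c k"
    then have "2 * i \<le> k" "Suc k \<le> 2 * i + 2" "2 * i + 2 \<le> 2 * N" using that(3) by (auto simp: c_def)
    then have "g (2 * i) \<le> g k" "g (Suc k) \<le> g (2 * i + 2)" using that by (auto intro!: g_mono)
    then show "x \<in> P i" using that by (auto simp: P_def)
  next
    assume x: "x \<in> P i"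
    show "i = c k"
    proof (rule ccontr)
      assume "i \<noteq> c k"
      then have "2 * i + 2 \<le> k \<or> Suc k \<le> 2 * i" by (auto simp: c_def)
      then have "g (2 * i + 2) \<le> g k \<or> g (Suc k) \<le> g (2 * i)" using that by (auto intro!: g_mono)
      then show False using x that by (auto simp: P_def)
    qed
  qed
  have a_mono: "a x \<le> a y" and b_mono: "b x \<le> b y" if "s \<le> x" "x \<le> y" "y \<le> t" for x y
    using that mono by (auto simp: mono_on_def)
  show ?thesis
  proof (rule that[of P z])
    fix i assume i: "i < N"
    show "P i \<in> sets borel" by (simp add: P_def)
    show "P i \<subseteq> {s<..t}" using g_mem[of "2 * i"] g_mem[of "2 * i + 2"] i by (auto simp: P_def)
    show "z i \<in> {s..t}" using g_mem[of "2 * i + 1"] i by (simp add: z_def)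
  next
    fix f :: "real \<Rightarrow> real"
    assume f: "f \<in> borel_measurable lebesgue" and f_fin: "mass p (\<lambda>y. \<bar>f y\<bar>) UNIV < top"
    let ?nf = "mass p (\<lambda>y. \<bar>f y\<bar>)"
    let ?I = "\<lambda>A. (LINT y:A|lebesgue. f y * v y)"
    define Ea where "Ea k = {a (g k)<..a (g (Suc k))}" for k
    define Eb where "Eb k = {b (g k)<..b (g (Suc k))}" for k
    have nf_fin: "?nf A < top" for A
    proof -
      have "?nf A \<le> ?nf UNIV" by (intro nn_integral_mono) (auto simp: indicator_def)
      then show ?thesis using f_fin by (rule le_less_trans)
    qed
    define X where "X k = enn2real (?nf (Ea k) + ?nf (Eb k))" for k
    have X: "?nf (Ea k) + ?nf (Eb k) = ennreal (X k)" "0 \<le> X k" for k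
      using nf_fin[of "Ea k"] nf_fin[of "Eb k"] by (auto simp: X_def)
    have int: "set_integrable lebesgue A (\<lambda>y. f y * v y)" if "A \<in> sets lebesgue" "A \<subseteq> {a s..b t}" for A
    proof (rule Hoelder_set_integrable[OF pq f v that(1) nf_fin])
      have "mass q v A \<le> mass q v {a s..b t}"
        using that(2) by (intro nn_integral_mono) (auto simp: indicator_def)
      then show "mass q v A < top" using V by (simp add: le_less_trans)
    qed
    have mass_union: "mass r u (A \<union> B) \<le> mass r u A + mass r u B"
      if "u \<in> borel_measurable lebesgue" "A \<in> sets lebesgue" "B \<in> sets lebesgue" for r u A B
    proof -
      have [measurable]: "u \<in> borel_measurable lebesgue" by fact
      have "mass r u (A \<union> B) \<le> (\<integral>\<^sup>+y. ennreal (u y powr r) * indicator A y + ennreal (u y powr r) * indicator B y \<partial>lebesgue)"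
        by (intro nn_integral_mono) (auto simp: indicator_def)
      also have "\<dots> = mass r u A + mass r u B"
        by (intro nn_integral_add borel_measurable_times_ennreal borel_measurable_indicator that) auto
      finally show ?thesis .
    qed
    have pointwise: "ennreal (\<bar>w x * ?I {a x..b x} - (\<Sum>i<N. (indicator (P i) x * w x) * ?I {a (z i)<..b (z i)})\<bar> powr p)
        \<le> ennreal (w x powr p) * ennreal (X k * (Vg k powr (1 / q)) powr p)"
      if x: "x \<in> {g k<..g (Suc k)}" and k: "k < 2 * N" for x k
    proof -
      have gk: "s \<le> g k" "g (Suc k) \<le> t" "g k \<le> g (Suc k)"
        using g_mem[of k] g_mem[of "Suc k"] g_mono[of k "Suc k"] k by auto
      have ck: "c k < N" using k by (auto simp: c_def)
      have zt: "z (c k) \<in> {s..t}" using gk z_c[of k] by auto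
      have "(\<Sum>i<N. (indicator (P i) x * w x) * ?I {a (z i)<..b (z i)})
          = (\<Sum>i<N. if i = c k then w x * ?I {a (z (c k))<..b (z (c k))} else 0)"
        using P_c[OF x k] by (intro sum.cong) (auto simp: indicator_def)
      also have "\<dots> = w x * ?I {a (z (c k))<..b (z (c k))}" using ck by simp
      finally have sum: "w x * ?I {a x..b x} - (\<Sum>i<N. (indicator (P i) x * w x) * ?I {a (z i)<..b (z i)})
          = w x * (?I {a x..b x} - ?I {a (z (c k))<..b (z (c k))})" by (simp add: algebra_simps)
      have range: "{a u..b u} \<subseteq> {a s..b t}" if "u \<in> {s..t}" for u
        using a_mono[of s u] b_mono[of u t] that by auto
      have "ennreal \<bar>?I {a x..b x} - ?I {a (z (c k))<..b (z (c k))}\<bar> \<le>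
          (\<integral>\<^sup>+y\<in>Ea k \<union> Eb k. ennreal \<bar>f y * v y\<bar> \<partial>lebesgue)"
      proof (rule set_integral_symmetric_difference)
        show "set_integrable lebesgue {a x..b x} (\<lambda>y. f y * v y)"
          using range[of x] gk x by (intro int) auto
        show "set_integrable lebesgue {a (z (c k))<..b (z (c k))} (\<lambda>y. f y * v y)"
          using range[OF zt] by (intro int) auto
        have lt: "a (g k) < a x" "b (g k) < b x"
          using gk x by (auto intro!: strict_mono_onD[OF smono(1)] strict_mono_onD[OF smono(2)])
        have le: "a x \<le> a (g (Suc k))" "b x \<le> b (g (Suc k))"
          using gk x by (auto intro!: a_mono b_mono)
        show "{a x..b x} - {a (z (c k))<..b (z (c k))} \<subseteq> Ea k \<union> Eb k"
        proof
          fix y assume y: "y \<in> {a x..b x} - {a (z (c k))<..b (z (c k))}"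
          from z_c[of k] show "y \<in> Ea k \<union> Eb k"
            by (elim disjE) (use y lt le in \<open>simp_all add: Ea_def Eb_def\<close>, linarith+)
        qed
        show "{a (z (c k))<..b (z (c k))} - {a x..b x} \<subseteq> Ea k \<union> Eb k"
        proof
          fix y assume y: "y \<in> {a (z (c k))<..b (z (c k))} - {a x..b x}"
          from z_c[of k] show "y \<in> Ea k \<union> Eb k"
            by (elim disjE) (use y lt le in \<open>simp_all add: Ea_def Eb_def\<close>, linarith+)
        qed
      qed
      also have "\<dots> \<le> ennreal (X k powr (1 / p) * Vg k powr (1 / q))"
      proof (rule Hoelder_on_set[OF pq f v])
        show "?nf (Ea k \<union> Eb k) \<le> ennreal (X k)"
          unfolding X(1)[symmetric] by (rule mass_union) (use f in \<open>auto simp: Ea_def Eb_def\<close>)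
        show "mass q v (Ea k \<union> Eb k) \<le> ennreal (Vg k)"
          unfolding Vg[OF k, symmetric] Ea_def Eb_def by (rule mass_union) (use v in auto)
      qed (use X Vg0[OF k] in \<open>auto simp: Ea_def Eb_def\<close>)
      finally have bound: "\<bar>?I {a x..b x} - ?I {a (z (c k))<..b (z (c k))}\<bar> \<le> X k powr (1 / p) * Vg k powr (1 / q)"
        by simp
      have "\<bar>w x * (?I {a x..b x} - ?I {a (z (c k))<..b (z (c k))})\<bar> powr p
          = w x powr p * \<bar>?I {a x..b x} - ?I {a (z (c k))<..b (z (c k))}\<bar> powr p"
        using w(2)[of x] by (simp add: abs_mult powr_mult)
      also have "\<dots> \<le> w x powr p * (X k powr (1 / p) * Vg k powr (1 / q)) powr p"
        using bound pq by (intro mult_left_mono powr_mono2) auto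
      also have "(X k powr (1 / p) * Vg k powr (1 / q)) powr p = X k * (Vg k powr (1 / q)) powr p"
        using pq X(2) by (simp add: powr_mult powr_powr)
      finally show ?thesis unfolding sum using X(2) by (simp flip: ennreal_mult add: ennreal_leI)
    qed
    have [measurable]: "w \<in> borel_measurable lebesgue" "f \<in> borel_measurable lebesgue" by fact+
    have grid_mass: "(\<Sum>k<2 * N. \<integral>\<^sup>+x\<in>{h (g k)<..h (g (Suc k))}. F x \<partial>lebesgue) = (\<integral>\<^sup>+x\<in>{h s<..h t}. F x \<partial>lebesgue)"
      if "F \<in> borel_measurable lebesgue" "mono_on {s..t} h" for F :: "real \<Rightarrow> ennreal" and h :: "real \<Rightarrow> real"
    proof -
      have hg: "h (g i) \<le> h (g j)" if "i \<le> j" "j \<le> 2 * N" for i j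
        using that g_mem[of i] g_mem[of j] g_mono[of i j] \<open>mono_on {s..t} h\<close> by (auto simp: mono_on_def)
      have "(\<Sum>k<2 * N. \<integral>\<^sup>+x\<in>{h (g k)<..h (g (Suc k))}. F x \<partial>lebesgue) =
          (\<integral>\<^sup>+x. (\<Sum>k<2 * N. F x * indicator {h (g k)<..h (g (Suc k))} x) \<partial>lebesgue)"
        by (intro nn_integral_sum[symmetric] borel_measurable_times_ennreal borel_measurable_indicator that) auto
      also have "\<dots> = (\<integral>\<^sup>+x. F x * indicator {h (g 0)<..h (g (2 * N))} x \<partial>lebesgue)"
        using sum_indicator_grid[of "2 * N" "\<lambda>i. h (g i)"] hg by (simp flip: sum_distrib_left)
      finally show ?thesis by (simp add: g0 gn)
    qed
    let ?err = "\<lambda>x. \<bar>w x * ?I {a x..b x} - (\<Sum>i<N. (indicator (P i) x * w x) * ?I {a (z i)<..b (z i)})\<bar>"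
    have "mass p ?err {s<..t} \<le> (\<integral>\<^sup>+x. (\<Sum>k<2 * N. ennreal (X k * (Vg k powr (1 / q)) powr p)
        * (ennreal (w x powr p) * indicator {g k<..g (Suc k)} x)) \<partial>lebesgue)"
    proof (rule nn_integral_mono)
      fix x
      have "ennreal (?err x powr p) * indicator {s<..t} x
          = (\<Sum>k<2 * N. ennreal (?err x powr p) * indicator {g k<..g (Suc k)} x)"
        using sum_indicator_grid[of "2 * N" g x] g_mono by (simp add: g0 gn flip: sum_distrib_left)
      also have "\<dots> \<le> (\<Sum>k<2 * N. ennreal (X k * (Vg k powr (1 / q)) powr p)
          * (ennreal (w x powr p) * indicator {g k<..g (Suc k)} x))"
        using pointwise by (intro sum_mono) (auto simp: indicator_def mult.commute)
      finally show "ennreal (?err x powr p) * indicator {s<..t} x \<le> \<dots>" .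
    qed
    also have "\<dots> = (\<Sum>k<2 * N. ennreal (X k * (Vg k powr (1 / q)) powr p) * mass p w {g k<..g (Suc k)})"
    proof -
      have m: "(\<lambda>x. ennreal (w x powr p) * indicator {g k<..g (Suc k)} x) \<in> borel_measurable lebesgue" for k
        by (intro borel_measurable_times_ennreal borel_measurable_indicator) auto
      show ?thesis
        by (subst nn_integral_sum)
           (auto simp only: nn_integral_cmult[OF m] intro!: borel_measurable_times_ennreal m borel_measurable_const)
    qed
    also have "\<dots> \<le> (\<Sum>k<2 * N. ennreal (\<epsilon> powr p) * (?nf (Ea k) + ?nf (Eb k)))"
    proof (rule sum_mono)
      fix k assume "k \<in> {..<2 * N}"
      then have k: "k < 2 * N" by simp
      have "X k * (Vg k powr (1 / q)) powr p * Wg k = X k * (Wg k powr (1 / p) * Vg k powr (1 / q)) powr p"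
        using pq Wg0[OF k] by (simp add: powr_mult powr_powr)
      also have "\<dots> \<le> X k * \<epsilon> powr p"
        using small[OF k] X(2) pq by (intro mult_left_mono powr_mono2) auto
      finally show "ennreal (X k * (Vg k powr (1 / q)) powr p) * mass p w {g k<..g (Suc k)}
          \<le> ennreal (\<epsilon> powr p) * (?nf (Ea k) + ?nf (Eb k))"
        unfolding X(1) Wg[OF k] using X(2) Wg0[OF k] by (simp flip: ennreal_mult add: ennreal_leI mult.commute)
    qed
    also have "\<dots> = ennreal (\<epsilon> powr p) * ((\<Sum>k<2 * N. ?nf (Ea k)) + (\<Sum>k<2 * N. ?nf (Eb k)))"
      by (simp add: sum_distrib_left sum.distrib distrib_left)
    also have "(\<Sum>k<2 * N. ?nf (Ea k)) = ?nf {a s<..a t}"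
      unfolding Ea_def by (rule grid_mass) (use mono in auto)
    also have "(\<Sum>k<2 * N. ?nf (Eb k)) = ?nf {b s<..b t}"
      unfolding Eb_def by (rule grid_mass) (use mono in auto)
    finally show "mass p ?err {s<..t} \<le> ennreal ((W powr (1 / p) * V powr (1 / q) / (2 * N)) powr p)
          * (?nf {a s<..a t} + ?nf {b s<..b t})" by (simp add: \<epsilon>_def)
  qed
qed

section \<open>Finite rank operators on the half-line\<close>

text \<open>Elements of \<open>L\<^sup>p\<close> are only measurable on the half-line; extended by zero they are
  measurable on the whole line.\<close>
definition ext0 :: "(real \<Rightarrow> real) \<Rightarrow> real \<Rightarrow> real" where
  "ext0 f y = (if 0 \<le> y then f y else 0)"

lemma ext0_measurable:
  assumes "f \<in> borel_measurable half_line"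
  shows "ext0 f \<in> borel_measurable lebesgue"
  using borel_measurable_if_I[OF assms] by (simp add: ext0_def[abs_def])

lemma ext0_eq [simp]: "0 \<le> y \<Longrightarrow> ext0 f y = f y"
  by (simp add: ext0_def)

lemma ext0_nonneg: "\<forall>x\<ge>0. 0 \<le> v x \<Longrightarrow> 0 \<le> ext0 v y"
  by (simp add: ext0_def)

lemma nn_integral_half_line_ext0:
  "(\<integral>\<^sup>+x. ennreal (\<bar>f x\<bar> powr p) \<partial>half_line) = mass p (\<lambda>y. \<bar>ext0 f y\<bar>) UNIV"
  by (subst nn_integral_restrict_space) (auto intro!: nn_integral_cong simp: ext0_def indicator_def)

lemma mass_ext0: "A \<subseteq> {0..} \<Longrightarrow> mass p (ext0 f) A = mass p f A"
  by (intro nn_integral_cong) (auto simp: ext0_def indicator_def)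

lemma set_integral_ext0:
  "A \<subseteq> {0..} \<Longrightarrow> (LINT y:A|lebesgue. ext0 f y * ext0 v y) = (LINT y:A|lebesgue. f y * v y)"
  unfolding set_lebesgue_integral_def
  by (intro Bochner_Integration.integral_cong) (auto simp: ext0_def indicator_def)

lemma Lp_ext0:
  assumes "f \<in> Lp p"
  shows "ext0 f \<in> borel_measurable lebesgue" "mass p (\<lambda>y. \<bar>ext0 f y\<bar>) UNIV < top"
  using assms ext0_measurable[of f] by (auto simp: Lp_def Lp_norm_finite_iff nn_integral_half_line_ext0)

lemma Lp_set_integrable:
  assumes pq: "1 < p" "1 < q" "1 / p + 1 / q = 1"
    and f: "f \<in> Lp p"
    and v: "v \<in> borel_measurable half_line" "\<forall>x\<ge>0. 0 \<le> v x"
    and D: "D \<in> sets lebesgue" "D \<subseteq> {0..}" "mass q v D < top"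
  shows "set_integrable lebesgue D (\<lambda>y. f y * v y)"
proof -
  have "set_integrable lebesgue D (\<lambda>y. ext0 f y * ext0 v y)"
  proof (rule Hoelder_set_integrable[OF pq Lp_ext0(1)[OF f] ext0_measurable[OF v(1)] _ D(1)])
    show "mass p (\<lambda>y. \<bar>ext0 f y\<bar>) D < top"
      using mass_subset[of D UNIV "\<lambda>y. \<bar>ext0 f y\<bar>" p] Lp_ext0(2)[OF f] by (auto intro: le_less_trans)
    show "mass q (ext0 v) D < top" using D mass_ext0 by simp
  qed (use v in \<open>auto simp: ext0_def\<close>)
  moreover have "(\<lambda>y. indicator D y *\<^sub>R (ext0 f y * ext0 v y)) = (\<lambda>y. indicator D y *\<^sub>R (f y * v y))"
    using D(2) by (auto simp: fun_eq_iff indicator_def ext0_def)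
  ultimately show ?thesis by (simp add: set_integrable_def)
qed

text \<open>A crude substitute for Minkowski's inequality; it only serves to show that certain norms
  are finite.\<close>
lemma sum_powr_le:
  fixes u :: "'q \<Rightarrow> real"
  assumes "finite Q" "1 \<le> p"
  shows "\<bar>\<Sum>q\<in>Q. u q\<bar> powr p \<le> real (card Q) powr p * (\<Sum>q\<in>Q. \<bar>u q\<bar> powr p)"
proof (cases "Q = {}")
  case False
  define M where "M = Max ((\<lambda>q. \<bar>u q\<bar>) ` Q)"
  have fin: "finite ((\<lambda>q. \<bar>u q\<bar>) ` Q)" "(\<lambda>q. \<bar>u q\<bar>) ` Q \<noteq> {}" using assms False by auto
  obtain q0 where q0: "q0 \<in> Q" "M = \<bar>u q0\<bar>" using Max_in[OF fin] by (auto simp: M_def)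
  have "\<bar>\<Sum>q\<in>Q. u q\<bar> \<le> (\<Sum>q\<in>Q. \<bar>u q\<bar>)" by (rule sum_abs)
  also have "\<dots> \<le> real (card Q) * M"
    using assms(1) by (intro sum_bounded_above) (auto simp: M_def)
  finally have "\<bar>\<Sum>q\<in>Q. u q\<bar> powr p \<le> (real (card Q) * M) powr p"
    using assms by (intro powr_mono2) auto
  also have "\<dots> = real (card Q) powr p * \<bar>u q0\<bar> powr p" using q0 by (simp add: powr_mult)
  also have "\<dots> \<le> real (card Q) powr p * (\<Sum>q\<in>Q. \<bar>u q\<bar> powr p)"
    using q0 assms(1) by (intro mult_left_mono member_le_sum) auto
  finally show ?thesis .
qed simp

lemma nn_integral_sum_powr_le:
  fixes e :: "'q \<Rightarrow> real \<Rightarrow> real"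
  assumes "finite Q" "1 \<le> p" and e: "\<And>q. q \<in> Q \<Longrightarrow> e q \<in> Lp p"
    and c: "\<And>q. q \<in> Q \<Longrightarrow> \<bar>c q\<bar> \<le> C q"
  shows "(\<integral>\<^sup>+x. ennreal (\<bar>\<Sum>q\<in>Q. e q x * c q\<bar> powr p) \<partial>half_line) \<le>
    ennreal (real (card Q) powr p) * (\<Sum>q\<in>Q. ennreal (C q powr p) * (\<integral>\<^sup>+x. ennreal (\<bar>e q x\<bar> powr p) \<partial>half_line))"
proof -
  have m [measurable]: "e q \<in> borel_measurable half_line" if "q \<in> Q" for q using e[OF that] by (simp add: Lp_def)
  have "(\<integral>\<^sup>+x. ennreal (\<bar>\<Sum>q\<in>Q. e q x * c q\<bar> powr p) \<partial>half_line) \<le>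
    (\<integral>\<^sup>+x. ennreal (real (card Q) powr p) * (\<Sum>q\<in>Q. ennreal (C q powr p) * ennreal (\<bar>e q x\<bar> powr p)) \<partial>half_line)"
  proof (rule nn_integral_mono)
    fix x
    have "\<bar>\<Sum>q\<in>Q. e q x * c q\<bar> powr p \<le> real (card Q) powr p * (\<Sum>q\<in>Q. \<bar>e q x * c q\<bar> powr p)"
      by (rule sum_powr_le) fact+
    also have "\<dots> \<le> real (card Q) powr p * (\<Sum>q\<in>Q. C q powr p * \<bar>e q x\<bar> powr p)"
    proof (intro mult_left_mono sum_mono)
      fix q assume "q \<in> Q"
      then have "\<bar>c q\<bar> powr p \<le> C q powr p" using c assms(2) by (intro powr_mono2) auto
      then show "\<bar>e q x * c q\<bar> powr p \<le> C q powr p * \<bar>e q x\<bar> powr p"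
        by (simp add: abs_mult powr_mult mult_right_mono mult.commute)
    qed simp
    finally show "ennreal (\<bar>\<Sum>q\<in>Q. e q x * c q\<bar> powr p) \<le>
        ennreal (real (card Q) powr p) * (\<Sum>q\<in>Q. ennreal (C q powr p) * ennreal (\<bar>e q x\<bar> powr p))"
      by (simp add: sum_nonneg sum_ennreal ennreal_leI flip: ennreal_mult)
  qed
  also have "\<dots> = ennreal (real (card Q) powr p) * (\<Sum>q\<in>Q. ennreal (C q powr p) * (\<integral>\<^sup>+x. ennreal (\<bar>e q x\<bar> powr p) \<partial>half_line))"
    by (simp add: nn_integral_cmult nn_integral_sum)
  finally show ?thesis .
qed

text \<open>The functionals \<open>f \<mapsto> \<integral>\<^sub>D f v\<close> are bounded on \<open>L\<^sup>p\<close> by Hoelder's inequality, so a finite sum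
  of such functionals with coefficients in \<open>L\<^sup>p\<close> is a bounded operator.\<close>
lemma finite_rank_operator:
  fixes e :: "'q \<Rightarrow> real \<Rightarrow> real" and D :: "'q \<Rightarrow> real set"
  assumes pq: "1 < p" "1 < q'" "1 / p + 1 / q' = 1"
    and v: "v \<in> borel_measurable half_line" "\<forall>x\<ge>0. 0 \<le> v x"
    and Q: "finite Q" and e: "\<And>q. q \<in> Q \<Longrightarrow> e q \<in> Lp p"
    and D: "\<And>q. q \<in> Q \<Longrightarrow> D q \<in> sets lebesgue" "\<And>q. q \<in> Q \<Longrightarrow> D q \<subseteq> {0..}"
      "\<And>q. q \<in> Q \<Longrightarrow> mass q' v (D q) < top"
  defines "K \<equiv> \<lambda>f x. \<Sum>q\<in>Q. e q x * (LINT y:D q|lebesgue. f y * v y)"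
  shows "Lp_operator p K" "Lp_rank p K \<le> enat (card Q)"
proof -
  let ?l = "\<lambda>q f. LINT y:D q|lebesgue. f y * v y"
  have int: "set_integrable lebesgue (D q) (\<lambda>y. f y * v y)" if "q \<in> Q" "f \<in> Lp p" for q f
    by (rule Lp_set_integrable[OF pq that(2) v D[OF that(1)]])
  have e_fin: "(\<integral>\<^sup>+x. ennreal (\<bar>e q x\<bar> powr p) \<partial>half_line) < top" if "q \<in> Q" for q
    using e[OF that] by (simp add: Lp_def Lp_norm_finite_iff)
  have bound_fin: "ennreal (real (card Q) powr p) *
      (\<Sum>q\<in>Q. ennreal (C q powr p) * (\<integral>\<^sup>+x. ennreal (\<bar>e q x\<bar> powr p) \<partial>half_line)) < top" for C
    using e_fin Q by (auto simp: ennreal_mult_less_top)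
  have add: "K (\<lambda>y. f y + g y) x = K f x + K g x" if "f \<in> Lp p" "g \<in> Lp p" for f g x
  proof -
    have "?l q (\<lambda>y. f y + g y) = ?l q f + ?l q g" if "q \<in> Q" for q
      using set_integral_add(2)[OF int[OF that \<open>f \<in> Lp p\<close>] int[OF that \<open>g \<in> Lp p\<close>]] by (simp add: distrib_right)
    then show ?thesis by (simp add: K_def distrib_left sum.distrib)
  qed
  have scale: "K (\<lambda>y. c * f y) x = c * K f x" for c f x
    by (simp add: K_def mult.assoc sum_distrib_left mult.left_commute)
  have AE_eq: "K f = K g" if f: "f \<in> Lp p" and g: "g \<in> Lp p" and eq: "AE x in half_line. f x = g x" for f g
  proof -
    have "?l q f = ?l q g" if q: "q \<in> Q" for q
      unfolding set_lebesgue_integral_def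
    proof (rule integral_cong_AE)
      have "AE x in lebesgue. x \<in> {0..} \<longrightarrow> f x = g x" using eq by (subst (asm) AE_restrict_space_iff) auto
      then show "AE x in lebesgue. indicator (D q) x *\<^sub>R (f x * v x) = indicator (D q) x *\<^sub>R (g x * v x)"
        by eventually_elim (use D(2)[OF q] in \<open>auto simp: indicator_def\<close>)
    qed (use int[OF q f] int[OF q g] in \<open>auto simp: set_integrable_def\<close>)
    then show ?thesis by (simp add: K_def fun_eq_iff)
  qed
  have mem: "K f \<in> Lp p" if "f \<in> Lp p" for f
    unfolding Lp_def
  proof (intro CollectI conjI)
    show "K f \<in> borel_measurable half_line"
      unfolding K_def using e by (intro borel_measurable_sum borel_measurable_times) (auto simp: Lp_def)
    have "(\<integral>\<^sup>+x. ennreal (\<bar>K f x\<bar> powr p) \<partial>half_line) < top"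
      unfolding K_def
      by (rule le_less_trans[OF nn_integral_sum_powr_le[where C = "\<lambda>q. \<bar>?l q f\<bar>"] bound_fin])
         (use Q pq e in auto)
    then show "Lp_norm p (K f) < top" by (simp add: Lp_norm_finite_iff)
  qed
  define C where "C q = enn2real (mass q' v (D q)) powr (1 / q')" for q
  have functional_bound: "\<bar>?l q f\<bar> \<le> C q" if q: "q \<in> Q" and f: "f \<in> Lp p" "Lp_norm p f \<le> 1" for q f
  proof -
    have "mass p (\<lambda>y. \<bar>ext0 f y\<bar>) UNIV \<le> ennreal 1"
      using f(2) Lp_norm_le_iff[of p 1 f] pq by (simp add: nn_integral_half_line_ext0)
    then have "mass p (\<lambda>y. \<bar>ext0 f y\<bar>) (D q) \<le> ennreal 1"
      using mass_subset[of "D q" UNIV "\<lambda>y. \<bar>ext0 f y\<bar>" p] by (auto intro: order_trans)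
    then have "(\<integral>\<^sup>+y\<in>D q. ennreal \<bar>ext0 f y * ext0 v y\<bar> \<partial>lebesgue)
        \<le> ennreal (1 powr (1 / p) * enn2real (mass q' v (D q)) powr (1 / q'))"
      using Lp_ext0(1)[OF f(1)] ext0_measurable[OF v(1)] D[OF q] v(2)
      by (intro Hoelder_on_set[OF pq]) (auto simp: mass_ext0 ext0_nonneg)
    moreover have "ennreal \<bar>?l q f\<bar> \<le> (\<integral>\<^sup>+y\<in>D q. ennreal \<bar>ext0 f y * ext0 v y\<bar> \<partial>lebesgue)"
    proof -
      have "ennreal \<bar>?l q f - (LINT y:{}|lebesgue. f y * v y)\<bar> \<le> (\<integral>\<^sup>+y\<in>D q. ennreal \<bar>f y * v y\<bar> \<partial>lebesgue)"
        by (rule set_integral_symmetric_difference) (use int[OF q f(1)] in \<open>auto simp: set_integrable_def\<close>)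
      also have "\<dots> = (\<integral>\<^sup>+y\<in>D q. ennreal \<bar>ext0 f y * ext0 v y\<bar> \<partial>lebesgue)"
        using D(2)[OF q] by (intro nn_integral_cong) (auto simp: indicator_def ext0_def)
      finally show ?thesis by (simp add: set_lebesgue_integral_def)
    qed
    ultimately have "ennreal \<bar>?l q f\<bar> \<le> ennreal (C q)"
      unfolding C_def powr_one_eq_one mult_1_left by (rule order_trans[rotated])
    then show ?thesis by (simp add: C_def)
  qed
  let ?B = "ennreal (real (card Q) powr p) *
      (\<Sum>q\<in>Q. ennreal (C q powr p) * (\<integral>\<^sup>+x. ennreal (\<bar>e q x\<bar> powr p) \<partial>half_line))"
  have "op_norm p K \<le> ?B epowr (1 / p)"
    unfolding op_norm_def
  proof (rule SUP_least)
    fix f assume f: "f \<in> {f \<in> Lp p. Lp_norm p f \<le> 1}"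
    show "Lp_norm p (K f) \<le> ?B epowr (1 / p)"
      unfolding Lp_norm_def K_def
    proof (intro epowr_mono nn_integral_sum_powr_le Q e)
      show "\<bar>?l q f\<bar> \<le> C q" if "q \<in> Q" for q using functional_bound[OF that] f by simp
    qed (use pq in auto)
  qed
  also have "\<dots> < top" using bound_fin[of C] by (auto simp: epowr_def less_top)
  finally have "op_norm p K < top" .
  then show "Lp_operator p K"
    unfolding Lp_operator_def
  proof (intro conjI ballI allI impI)
    fix f g assume "f \<in> Lp p" "g \<in> Lp p" "AE x in half_line. f x = g x"
    then show "AE x in half_line. K f x = K g x" by (simp only: AE_eq[of f g] AE_I2)
  qed (auto simp: mem add scale)
  obtain h where h: "bij_betw h {..<card Q} Q"
    using ex_bij_betw_nat_finite[OF Q] by (auto simp: atLeast0LessThan)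
  show "Lp_rank p K \<le> enat (card Q)"
    unfolding Lp_rank_def
  proof (intro Inf_lower CollectI exI conjI refl allI impI ballI)
    show "e (h i) \<in> Lp p" if "i < card Q" for i using h that e by (auto simp: bij_betw_def)
    show "AE x in half_line. K f x = (\<Sum>i<card Q. ?l (h i) f * e (h i) x)" for f
      unfolding K_def by (subst sum.reindex_bij_betw[OF h, symmetric]) (simp add: mult.commute)
  qed simp
qed

lemma approx_number_le:
  assumes "Lp_operator p K" "Lp_rank p K \<le> enat n" "1 < p" "0 \<le> c"
    and "\<And>f. f \<in> Lp p \<Longrightarrow> Lp_norm p f \<le> 1 \<Longrightarrow>
      (\<integral>\<^sup>+x. ennreal (\<bar>T f x - K f x\<bar> powr p) \<partial>half_line) \<le> ennreal (c powr p)"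
  shows "approx_number p T (Suc n) \<le> ennreal c"
proof -
  have "approx_number p T (Suc n) \<le> op_norm p (\<lambda>f x. T f x - K f x)"
    unfolding approx_number_def
    using assms(1,2) by (intro INF_lower) (auto intro: le_less_trans)
  also have "\<dots> \<le> ennreal c"
    unfolding op_norm_def using assms(3-) by (intro SUP_least) (auto simp: Lp_norm_le_iff)
  finally show ?thesis .
qed

lemma approx_number_antimono: "antimono (approx_number p T)"
  unfolding approx_number_def
  by (intro antimonoI INF_superset_mono) (auto intro: less_le_trans)

section \<open>Boundary functions and partition points\<close>

text \<open>The limits at \<open>0\<close> and \<open>\<infinity>\<close> and the intermediate value theorem make a boundary function a
  bijection of the positive reals, so \<open>pos_inv\<close> is its true inverse there.\<close>
lemma boundary_functionD:
  assumes "boundary_function a"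
  shows "continuous_on {0<..} a" "strict_mono_on {0<..} a" "\<And>x. 0 < x \<Longrightarrow> 0 < a x"
    "\<And>y. 0 < y \<Longrightarrow> 0 < pos_inv a y" "\<And>y. 0 < y \<Longrightarrow> a (pos_inv a y) = y"
proof -
  show cont: "continuous_on {0<..} a"
    using assms by (auto simp: boundary_function_def intro: differentiable_imp_continuous_on)
  show mono: "strict_mono_on {0<..} a" using assms by (simp add: boundary_function_def)
  have lim0: "(a \<longlongrightarrow> 0) (at_right 0)" and lim_top: "filterlim a at_top at_top"
    using assms by (auto simp: boundary_function_def)
  show pos: "0 < a x" if "0 < x" for x
  proof -
    have "\<forall>\<^sub>F u in at_right 0. a u \<le> a (x / 2)"
      using eventually_at_right_real[of 0 "x / 2"] that
      by (auto elim!: eventually_mono intro!: less_imp_le strict_mono_onD[OF mono])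
    then have "0 \<le> a (x / 2)" by (intro tendsto_upperbound[OF lim0]) auto
    also have "\<dots> < a x" using that by (intro strict_mono_onD[OF mono]) auto
    finally show ?thesis .
  qed
  have surj: "\<exists>x>0. a x = y" if "0 < y" for y
  proof -
    have "\<forall>\<^sub>F u in at_right 0. a u < y \<and> u > 0"
      using order_tendstoD(2)[OF lim0 that] eventually_at_right_less[of 0] by eventually_elim simp
    then obtain s where s: "a s < y" "0 < s" using eventually_happens trivial_limit_at_right_real by blast
    have "\<forall>\<^sub>F u in at_top. y < a u \<and> s < u"
      using filterlim_at_top_dense[THEN iffD1, OF lim_top, rule_format, of y] eventually_gt_at_top[of s]
      by eventually_elim simp
    then obtain t where t: "y < a t" "s < t" using eventually_happens trivial_limit_at_top_linorder by blast
    have "\<exists>x\<ge>s. x \<le> t \<and> a x = y"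
      by (rule IVT') (use s t in \<open>auto intro: continuous_on_subset[OF cont]\<close>)
    then obtain x where "s \<le> x" "a x = y" by blast
    then show ?thesis using s by (intro exI[of _ x]) auto
  qed
  fix y :: real assume "0 < y"
  then have "y \<in> a ` {0<..}" using surj by force
  moreover have "inj_on a {0<..}" using mono by (rule strict_mono_on_imp_inj_on)
  ultimately show "0 < pos_inv a y" "a (pos_inv a y) = y"
    using the_inv_into_into[of a "{0<..}" y "{0<..}"] f_the_inv_into_f[of a "{0<..}" y] by auto
qed

text \<open>The relation \<open>b(\<xi>\<^sub>k) = a(\<xi>\<^sub>k\<^sub>+\<^sub>1)\<close> holds on both sides of \<open>\<xi>\<^sub>0\<close>, although \<open>\<xi>\<close> is defined by
  different iterations there; with \<open>a < b\<close> it forces \<open>\<xi>\<close> to increase.\<close>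
lemma \<xi>_step:
  assumes "boundaries a b"
  shows "0 < \<xi> a b k" "a (\<xi> a b (k + 1)) = b (\<xi> a b k)" "\<xi> a b k < \<xi> a b (k + 1)"
proof -
  have a: "boundary_function a" and b: "boundary_function b" and lt: "\<And>x. 0 < x \<Longrightarrow> a x < b x"
    using assms by (auto simp: boundaries_def)
  note A = boundary_functionD[OF a] and B = boundary_functionD[OF b]
  have pos_f: "0 < ((pos_inv a \<circ> b) ^^ n) 1" "0 < ((pos_inv b \<circ> a) ^^ n) 1" for n
    by (induction n) (auto intro: A(3,4) B(3,4))
  then show pos: "0 < \<xi> a b k" for k by (simp add: \<xi>_def)
  show step: "a (\<xi> a b (k + 1)) = b (\<xi> a b k)"
  proof (cases "0 \<le> k")
    case True
    then have "nat (k + 1) = Suc (nat k)" by simp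
    then have "\<xi> a b (k + 1) = pos_inv a (b (\<xi> a b k))" using True by (simp add: \<xi>_def)
    then show ?thesis using A(5) B(3) pos by simp
  next
    case False
    then have "nat (- k) = Suc (nat (- (k + 1)))" by simp
    then have "\<xi> a b k = pos_inv b (a (\<xi> a b (k + 1)))" using False
      by (cases "k = -1") (auto simp: \<xi>_def)
    then show ?thesis using B(5) A(3) pos by simp
  qed
  show "\<xi> a b k < \<xi> a b (k + 1)"
  proof (rule ccontr)
    assume "\<not> \<xi> a b k < \<xi> a b (k + 1)"
    then have "a (\<xi> a b (k + 1)) \<le> a (\<xi> a b k)"
      using strict_mono_on_leD[OF A(2)] pos by simp
    then show False using step lt[OF pos[of k]] by simp
  qed
qed

text \<open>
  All \<open>\<xi>\<^sub>k\<close> are partition points, and their indices increase by at least one with \<open>k\<close>, hence are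
  unbounded in both directions.  So \<open>[x\<^sub>m, x\<^sub>m\<^sub>+\<^sub>1]\<close> lies in some \<open>[\<xi>\<^sub>k, \<xi>\<^sub>k\<^sub>+\<^sub>1]\<close>, and
  \<open>a(x\<^sub>m\<^sub>+\<^sub>1) \<le> a(\<xi>\<^sub>k\<^sub>+\<^sub>1) = b(\<xi>\<^sub>k) \<le> b(x\<^sub>m)\<close>: the two boundaries sweep separate ranges.
\<close>
lemma partition_points_bounds:
  assumes ab: "boundaries a b" and x: "partition_points a b \<sigma> x"
  shows "0 < x m" "x m < x (m + 1)" "a (x (m + 1)) \<le> b (x m)"
proof -
  obtain ja jb X where blk: "\<And>k. block a b \<sigma> k (ja k) (jb k) (X k)"
    and rng: "range x = (\<Union>k. X k ` {- ja k..jb k - 1})" and sm: "strict_mono x"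
    using x by (auto simp: partition_points_def)
  have "\<exists>i. x i = \<xi> a b k" for k :: int
  proof -
    have "1 \<le> ja k" "1 \<le> jb k" "X k (- ja k) = \<xi> a b k"
      using blk[of k] by (auto simp: block_def not_le[symmetric])
    then have "\<xi> a b k \<in> range x" unfolding rng by (intro UN_I[of k] image_eqI[of _ _ "- ja k"]) auto
    then show ?thesis by force
  qed
  then obtain idx where idx: "\<And>k. x (idx k) = \<xi> a b k" by metis
  have idx_step: "idx k + 1 \<le> idx (k + 1)" for k
    using \<xi>_step(3)[OF ab, of k] strict_mono_less[OF sm] idx by (metis zless_imp_add1_zle)
  have up: "idx k + int n \<le> idx (k + int n)" for k n
  proof (induction n)
    case (Suc n)
    then show ?case using idx_step[of "k + int n"] by (simp add: add_ac)
  qed simp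
  define k0 where "k0 = - int (nat (idx 0 - m))"
  have k0: "idx k0 \<le> m"
    using up[of k0 "nat (idx 0 - m)"] by (cases "m \<le> idx 0") (auto simp: k0_def)
  have "\<exists>k. idx k \<le> m \<and> m < idx (k + 1)"
  proof (rule ccontr)
    assume contra: "\<nexists>k. idx k \<le> m \<and> m < idx (k + 1)"
    have "idx (k0 + int n) \<le> m" for n
    proof (induction n)
      case (Suc n)
      then show ?case using contra by (metis add.assoc add.commute not_le of_nat_Suc)
    qed (use k0 in simp)
    moreover have "m < idx (k0 + int (nat (m - idx k0 + 1)))"
      using up[of k0 "nat (m - idx k0 + 1)"] k0 by simp
    ultimately show False by (metis not_le)
  qed
  then obtain k where k: "idx k \<le> m" "m + 1 \<le> idx (k + 1)" by auto
  have lo: "\<xi> a b k \<le> x m" and hi: "x (m + 1) \<le> \<xi> a b (k + 1)"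
    using k strict_mono_less_eq[OF sm] by (auto simp flip: idx)
  show pos: "0 < x m" using lo \<xi>_step(1)[OF ab, of k] by simp
  show lt: "x m < x (m + 1)" using strict_monoD[OF sm, of m "m + 1"] by simp
  have sm_ab: "strict_mono_on {0<..} a" "strict_mono_on {0<..} b"
    using ab boundary_functionD(2) by (auto simp: boundaries_def)
  have "a (x (m + 1)) \<le> a (\<xi> a b (k + 1))"
    using hi pos lt \<xi>_step(1)[OF ab] by (intro strict_mono_on_leD[OF sm_ab(1)]) auto
  moreover have "b (\<xi> a b k) \<le> b (x m)"
    using lo pos \<xi>_step(1)[OF ab] by (intro strict_mono_on_leD[OF sm_ab(2)]) auto
  ultimately show "a (x (m + 1)) \<le> b (x m)" using \<xi>_step(2)[OF ab, of k] by simp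
qed

text \<open>Ensures that the image of the operator is measurable: near a given point the integral is
  a difference of two values of one primitive, composed with \<open>a\<close> and \<open>b\<close>.\<close>
lemma continuous_on_window_integral:
  fixes a b h :: "real \<Rightarrow> real"
  assumes ab: "boundaries a b"
    and h: "\<And>c d. 0 < c \<Longrightarrow> c \<le> d \<Longrightarrow> set_integrable lebesgue {c..d} h"
  shows "continuous_on {0<..} (\<lambda>x. LINT y:{a x..b x}|lebesgue. h y)"
proof (rule continuous_at_imp_continuous_on, rule ballI)
  have a: "boundary_function a" and b: "boundary_function b" and lt: "\<And>x. 0 < x \<Longrightarrow> a x < b x"
    using ab by (auto simp: boundaries_def)
  note A = boundary_functionD[OF a] and B = boundary_functionD[OF b]
  fix x0 :: real assume "x0 \<in> {0<..}"
  then have x0: "0 < x0" by simp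
  define I where "I = {x0 / 2..2 * x0}"
  define c where "c = a (x0 / 2)"
  define d where "d = b (2 * x0)"
  have c: "0 < c" using A(3) x0 by (simp add: c_def)
  have rng: "c \<le> a x" "a x < b x" "b x \<le> d" if "x \<in> I" for x
    using that x0 lt[of x] by (auto simp: I_def c_def d_def intro!: strict_mono_on_leD[OF A(2)] strict_mono_on_leD[OF B(2)])
  have "c \<le> d" using rng[of x0] x0 by (simp add: I_def)
  have int: "h integrable_on {c..d}"
    by (rule set_lebesgue_integral_eq_integral(1)[OF h[OF c \<open>c \<le> d\<close>]])
  have cF: "continuous_on {c..d} (\<lambda>y. integral {c..y} h)"
    by (rule indefinite_integral_continuous_1[OF int])
  have contI: "continuous_on I a" "continuous_on I b"
    using x0 by (auto simp: I_def intro: continuous_on_subset[OF A(1)] continuous_on_subset[OF B(1)])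
  have "continuous_on I (\<lambda>x. integral {c..b x} h - integral {c..a x} h)"
    by (intro continuous_on_diff continuous_on_compose2[OF cF] contI)
       (use rng in \<open>force intro: less_imp_le\<close>)+
  also have "?this \<longleftrightarrow> continuous_on I (\<lambda>x. LINT y:{a x..b x}|lebesgue. h y)"
  proof (rule continuous_on_cong[OF refl])
    fix x assume x: "x \<in> I"
    have "(LINT y:{a x..b x}|lebesgue. h y) = integral {a x..b x} h"
      using rng[OF x] c by (intro set_lebesgue_integral_eq_integral(2) h) auto
    moreover have "integral {c..a x} h + integral {a x..b x} h = integral {c..b x} h"
      using rng[OF x] by (intro Henstock_Kurzweil_Integration.integral_combine integrable_on_subinterval[OF int]) auto
    ultimately show "integral {c..b x} h - integral {c..a x} h = (LINT y:{a x..b x}|lebesgue. h y)" by simp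
  qed
  finally show "isCont (\<lambda>x. LINT y:{a x..b x}|lebesgue. h y) x0"
    by (rule continuous_on_interior) (use x0 in \<open>auto simp: I_def\<close>)
qed
lemma \<mu>_finite:
  assumes p: "1 < p" and set: "hs_setting p v w a b \<sigma>" and x: "partition_points a b \<sigma> x"
  shows "mass p w {x m..x (m + 1)} < top" "mass (conj_exp p) v {a (x m)..b (x (m + 1))} < top"
    "\<mu> p v w a b x m = ennreal (enn2real (mass p w {x m..x (m + 1)}) powr (1 / p) *
        enn2real (mass (conj_exp p) v {a (x m)..b (x (m + 1))}) powr (1 / conj_exp p))"
proof -
  have ab: "boundaries a b" using set by (simp add: hs_setting_def)
  then have pos: "0 < a (x m)"
    using partition_points_bounds(1)[OF ab x, of m] boundary_functionD(3) by (auto simp: boundaries_def)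
  have local: "mass p w C < top" "mass (conj_exp p) v C < top" if "compact C" "C \<subseteq> {0<..}" for C
    using set that by (auto simp: hs_setting_def weight_on_def)
  show W: "mass p w {x m..x (m + 1)} < top"
    using partition_points_bounds(1)[OF ab x, of m] by (intro local) auto
  show V: "mass (conj_exp p) v {a (x m)..b (x (m + 1))} < top"
    using pos by (intro local) auto
  show "\<mu> p v w a b x m = ennreal (enn2real (mass p w {x m..x (m + 1)}) powr (1 / p) *
        enn2real (mass (conj_exp p) v {a (x m)..b (x (m + 1))}) powr (1 / conj_exp p))"
    using W[THEN less_imp_neq] V[THEN less_imp_neq] by (simp add: \<mu>_def epowr_def ennreal_mult)
qed

section \<open>A lower bound for the norm constant\<close>

lemma mass_reciprocal:
  assumes "0 < l" "l \<le> r"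
  shows "(\<integral>\<^sup>+y\<in>{l..r}. ennreal (1 / y) \<partial>lebesgue) = ennreal (ln (r / l))"
proof -
  have "((\<lambda>y. 1 / y) has_integral (ln r - ln l)) {l..r}"
    using assms
    by (intro fundamental_theorem_of_calculus)
       (auto intro!: derivative_eq_intros simp flip: has_real_derivative_iff_has_vector_derivative)
  then have "(\<integral>\<^sup>+y\<in>{l..r}. ennreal (1 / y) \<partial>lborel) = ennreal (ln r - ln l)"
    using assms by (intro nn_integral_has_integral_lebesgue') auto
  then show ?thesis using assms by (simp add: nn_integral_completion ln_div)
qed

lemma pos_inv_scale:
  assumes "0 < c" "0 < y"
  shows "pos_inv (\<lambda>t. c * t) y = y / c"
  by (rule the_inv_into_f_eq) (use assms in \<open>auto simp: inj_on_def\<close>)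

text \<open>
  A scale-invariant example in which everything is explicit: \<open>a(t) = t\<close>, \<open>b(t) = 2t\<close> and
  \<open>v\<^sup>q = 1/y\<close>, so that masses of \<open>v\<^sup>q\<close> are logarithms of quotients.  Then \<open>\<xi>\<^sub>k = 2\<^sup>k\<close>, the
  fairway is \<open>\<surd>2 t\<close>, each block has exactly one inner point, and \<open>x\<^sub>m = 2\<^sup>m\<^sup>/\<^sup>2\<close>.  The window
  that enters \<open>\<mu>\<^sub>m\<close> has mass \<open>ln 2\<^sup>3\<^sup>/\<^sup>2 = 3/2 ln 2\<close> for every \<open>m\<close>.  With \<open>c = 2\<^sup>1\<^sup>/\<^sup>4\<close>, for all
  \<open>t\<close> in \<open>[1, c]\<close> the window \<open>[t, 2t]\<close> contains \<open>[c, 2]\<close>, of mass \<open>3/4 ln 2\<close>, exactly half as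
  much.  So for \<open>w\<close> concentrated on \<open>[1, c]\<close> and the extremal function of Hoelder's inequality
  on \<open>[c, 2]\<close>, the norm estimate gives \<open>\<gamma> \<ge> (1/2)\<^sup>1\<^sup>/\<^sup>q \<ge> 1/2\<close>.

  The boundary \<open>a\<close> is written \<open>\<lambda>t. 1 * t\<close> so that both boundaries are scalings.
\<close>
context
  fixes p q :: real and v w \<sigma> :: "real \<Rightarrow> real" and x :: "int \<Rightarrow> real" and c :: real
  assumes p: "1 < p"
  defines "q \<equiv> conj_exp p"
  defines "v \<equiv> \<lambda>y. y powr (- 1 / q)"
  defines "c \<equiv> 2 powr (1 / 4)"
  defines "w \<equiv> indicator {1..c}"
  defines "\<sigma> \<equiv> \<lambda>t. 2 powr (1 / 2) * t"
  defines "x \<equiv> \<lambda>m. 2 powr (real_of_int m / 2)"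
begin

private lemma q: "1 < q" "1 / p + 1 / q = 1"
  using p by (auto simp: q_def conj_exp_def field_simps)

private lemma v_powr: "0 < y \<Longrightarrow> v y powr q = 1 / y"
proof -
  assume "0 < y"
  have "v y powr q = y powr (- 1)" using q(1) by (simp add: v_def powr_powr)
  then show ?thesis using \<open>0 < y\<close> by (simp add: powr_minus_divide)
qed

private lemma v_mass: "0 < l \<Longrightarrow> l \<le> r \<Longrightarrow> mass q v {l..r} = ennreal (ln (r / l))"
  by (subst mass_reciprocal[symmetric]) (auto intro!: nn_integral_cong simp: v_powr indicator_def)

private lemma c: "1 < c" "c < 2" "ln (2 / c) = 3 / 4 * ln 2"
  using powr_less_mono[of "1 / 4" 1 "2::real"] by (auto simp: c_def ln_div ln_powr)

private lemma model_boundary: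
  assumes "0 < r"
  shows "boundary_function (\<lambda>t. r * t)"
  unfolding boundary_function_def
proof (intro conjI)
  show "((\<lambda>t. r * t) \<longlongrightarrow> 0) (at_right 0)" by (auto intro!: tendsto_eq_intros)
  show "filterlim (\<lambda>t. r * t) at_top at_top"
    by (rule filterlim_tendsto_pos_mult_at_top[OF tendsto_const assms filterlim_ident])
  show "strict_mono_on {0<..} (\<lambda>t. r * t)" using assms by (auto simp: strict_mono_on_def)
  show "(\<lambda>t. r * t) differentiable_on {0<..}" by (intro derivative_intros)
qed simp

private lemma model_boundaries: "boundaries (\<lambda>t. 1 * t) (\<lambda>t. 2 * t)"
  unfolding boundaries_def by (auto intro: model_boundary simp del: mult_1)

private lemma model_setting: "hs_setting p v w (\<lambda>t. 1 * t) (\<lambda>t. 2 * t) \<sigma>"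
  unfolding hs_setting_def
proof (intro conjI model_boundaries)
  have sub: "\<exists>l r. 0 < l \<and> l \<le> r \<and> C \<subseteq> {l..r}" if C: "compact C" "C \<subseteq> {0<..}" for C :: "real set"
  proof (cases "C = {}")
    case True
    then show ?thesis by (intro exI[of _ 1]) auto
  next
    case False
    obtain l where l: "l \<in> C" "\<forall>y\<in>C. l \<le> y" using compact_attains_inf[OF C(1) False] by blast
    obtain r where r: "r \<in> C" "\<forall>y\<in>C. y \<le> r" using compact_attains_sup[OF C(1) False] by blast
    show ?thesis using l r C(2) by (intro exI[of _ l] exI[of _ r]) auto
  qed
  show "weight_on (conj_exp p) v"
    unfolding weight_on_def
  proof (intro conjI allI impI)
    show "v \<in> borel_measurable half_line"
      unfolding v_def by (intro borel_measurable_half_lineI) measurable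
    show "0 \<le> v y" for y by (simp add: v_def)
    fix C :: "real set" assume "compact C \<and> C \<subseteq> {0<..}"
    then obtain l r where lr: "0 < l" "l \<le> r" "C \<subseteq> {l..r}" using sub by blast
    have "mass q v C \<le> mass q v {l..r}" by (rule mass_subset) fact
    then show "mass (conj_exp p) v C < top" using v_mass[OF lr(1,2)] by (simp add: q_def le_less_trans)
  qed
  show "weight_on p w"
    unfolding weight_on_def
  proof (intro conjI allI impI)
    show "w \<in> borel_measurable half_line"
      unfolding w_def by (intro borel_measurable_half_lineI) measurable
    show "0 \<le> w y" for y by (simp add: w_def)
    fix C :: "real set"
    have "mass p w C \<le> (\<integral>\<^sup>+y. indicator {1..c} y \<partial>lebesgue)"
      by (intro nn_integral_mono) (auto simp: w_def indicator_def)
    also have "\<dots> < top" using c by simp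
    finally show "mass p w C < top" .
  qed
  show "fairway p v (\<lambda>t. 1 * t) (\<lambda>t. 2 * t) \<sigma>"
    unfolding fairway_def
  proof (intro conjI allI impI)
    show "strict_mono_on {0<..} \<sigma>" by (auto simp: \<sigma>_def strict_mono_on_def)
    show "bij_betw \<sigma> {0<..} {0<..}"
      by (rule bij_betwI[where g = "\<lambda>t. t / 2 powr (1 / 2)"]) (auto simp: \<sigma>_def)
    fix t :: real assume t: "0 < t"
    have "(1::real) < 2 powr (1 / 2)" "2 powr (1 / 2) < (2::real)"
      using powr_less_mono[of "1 / 2" 1 "2::real"] by auto
    then show "1 * t < \<sigma> t" "\<sigma> t < 2 * t" using t by (auto simp: \<sigma>_def)
    have "ln (\<sigma> t / (1 * t)) = ln (2 * t / \<sigma> t)" using t by (simp add: \<sigma>_def ln_div ln_powr)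
    then show "mass (conj_exp p) v {1 * t..\<sigma> t} = mass (conj_exp p) v {\<sigma> t..2 * t}"
      using t \<open>1 * t < \<sigma> t\<close> \<open>\<sigma> t < 2 * t\<close> by (simp add: v_mass flip: q_def)
  qed
qed

private lemma model_\<xi>: "\<xi> (\<lambda>t. 1 * t) (\<lambda>t. 2 * t) k = 2 powr real_of_int k"
proof -
  have step: "\<xi> (\<lambda>t. 1 * t) (\<lambda>t. 2 * t) (k + 1) = 2 * \<xi> (\<lambda>t. 1 * t) (\<lambda>t. 2 * t) k" for k
    using \<xi>_step(2)[OF model_boundaries, of k] by simp
  show ?thesis
  proof (induction k rule: int_induct[of _ 0])
    case base
    then show ?case by (simp add: \<xi>_def)
  next
    case (step1 i)
    then show ?case using step[of i] by (simp add: powr_add)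
  next
    case (step2 i)
    then show ?case using step[of "i - 1"] by (simp add: powr_diff)
  qed
qed

private lemma model_partition: "partition_points (\<lambda>t. 1 * t) (\<lambda>t. 2 * t) \<sigma> x"
  unfolding partition_points_def
proof (intro conjI exI allI)
  show "strict_mono x" by (auto simp: strict_mono_def x_def)
  define X :: "int \<Rightarrow> int \<Rightarrow> real" where "X k j = 2 powr (real_of_int k + (real_of_int j + 1) / 2)" for k j
  have inv: "pos_inv \<sigma> (2 powr u) = 2 powr (u - 1 / 2)" for u
    unfolding \<sigma>_def by (subst pos_inv_scale) (auto simp: powr_diff)
  have dbl: "2 * 2 powr u = 2 powr (u + 1)" for u :: real by (simp add: powr_add)
  show "block (\<lambda>t. 1 * t) (\<lambda>t. 2 * t) \<sigma> k ((\<lambda>_. 1) k) ((\<lambda>_. 1) k) (X k)" for k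
    unfolding block_def model_\<xi> unfolding X_def dbl mult_1 inv by (auto simp: field_simps)
  show "range x = (\<Union>k. X k ` {- (\<lambda>_. 1) k..(\<lambda>_. 1) k - 1})"
  proof (intro equalityI subsetI)
    fix y assume "y \<in> range x"
    then obtain m where y: "y = x m" by auto
    show "y \<in> (\<Union>k. X k ` {- (\<lambda>_. 1) k..(\<lambda>_. 1) k - 1})"
    proof (cases "even m")
      case True
      then obtain k where "m = 2 * k" by (elim evenE)
      then have "y = X k (- 1)" by (simp add: y x_def X_def)
      then show ?thesis by (intro UN_I[of k]) auto
    next
      case False
      then obtain k where "m = 2 * k + 1" by (elim oddE)
      then have "y = X k 0" by (simp add: y x_def X_def add_divide_distrib)
      then show ?thesis by (intro UN_I[of k]) auto
    qed
  next
    fix y assume "y \<in> (\<Union>k. X k ` {- (\<lambda>_. 1) k..(\<lambda>_. 1) k - 1})"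
    then obtain k j where "y = X k j" by auto
    then have "y = x (2 * k + j + 1)" by (simp add: X_def x_def add_divide_distrib add.assoc)
    then show "y \<in> range x" by simp
  qed
qed

lemma norm_constant_ge_half:
  assumes \<gamma>: "norm_constant p \<gamma>"
  shows "1 / 2 \<le> \<gamma>"
proof -
  \<comment> \<open>\<open>B\<close> is the mass of \<open>v\<^sup>q\<close> on \<open>[c, 2]\<close>, and \<open>A\<close> normalises the test function.\<close>
  define B where "B = 3 / 4 * ln (2::real)"
  have B: "0 < B" "ln (2 / c) = B" using c by (auto simp: B_def)
  define A where "A = B powr (- 1 / p)"
  define f where "f y = indicator {c..2} y * (A * y powr (- 1 / p))" for y
  let ?H = "hardy_steklov v w (\<lambda>t. 1 * t) (\<lambda>t. 2 * t) f"
  have f_mass: "(\<integral>\<^sup>+y. ennreal (\<bar>f y\<bar> powr p) \<partial>half_line) \<le> ennreal (1 powr p)"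
  proof -
    have "(\<integral>\<^sup>+y. ennreal (\<bar>f y\<bar> powr p) \<partial>half_line) \<le> (\<integral>\<^sup>+y. ennreal (\<bar>f y\<bar> powr p) \<partial>lebesgue)"
      by (subst nn_integral_restrict_space) (auto intro!: nn_integral_mono simp: indicator_def)
    also have "\<dots> = (\<integral>\<^sup>+y. ennreal (1 / B) * (ennreal (1 / y) * indicator {c..2} y) \<partial>lebesgue)"
    proof (intro nn_integral_cong)
      fix y
      have "(A * y powr (- 1 / p)) powr p = 1 / B * (1 / y)" if "c \<le> y"
      proof -
        have "(A * y powr (- 1 / p)) powr p = B powr (- 1) * y powr (- 1)"
          using p by (simp add: A_def powr_mult powr_powr)
        then show ?thesis using that c B by (simp add: powr_minus_divide)
      qed
      moreover have "0 \<le> A * y powr (- 1 / p)" by (simp add: A_def)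
      ultimately show "ennreal (\<bar>f y\<bar> powr p) = ennreal (1 / B) * (ennreal (1 / y) * indicator {c..2} y)"
        using c B by (auto simp: f_def indicator_def simp flip: ennreal_mult)
    qed
    also have "\<dots> = ennreal (1 / B) * (\<integral>\<^sup>+y\<in>{c..2}. ennreal (1 / y) \<partial>lebesgue)"
      by (intro nn_integral_cmult borel_measurable_times_ennreal borel_measurable_indicator
          measurable_completion) auto
    also have "\<dots> = 1" using c B by (simp add: mass_reciprocal flip: ennreal_mult)
    finally show ?thesis by simp
  qed
  have f_Lp: "f \<in> Lp p" "Lp_norm p f \<le> 1"
  proof -
    show N: "Lp_norm p f \<le> 1" using f_mass Lp_norm_le_iff[of p 1 f] p by simp
    have "f \<in> borel_measurable half_line"
      unfolding f_def by (intro borel_measurable_half_lineI) measurable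
    then show "f \<in> Lp p" using N by (auto simp: Lp_def intro: le_less_trans)
  qed
  have H: "?H t = A * B" if t: "t \<in> {1..c}" for t
  proof -
    have "(LINT y:{1 * t..2 * t}|lebesgue. f y * v y) = (LINT y:{c..2}|lebesgue. A * (1 / y))"
      unfolding set_lebesgue_integral_def
    proof (intro Bochner_Integration.integral_cong refl)
      fix y
      have "(A * y powr (- 1 / p)) * y powr (- 1 / q) = A * (1 / y)" if "c \<le> y"
      proof -
        have "y powr (- 1 / p) * y powr (- 1 / q) = y powr (- 1 / p + - 1 / q)"
          by (rule powr_add[symmetric])
        also have "- 1 / p + - 1 / q = - 1" using q(2) by simp
        finally show ?thesis using that c by (simp add: powr_minus_divide mult.assoc)
      qed
      then show "indicator {1 * t..2 * t} y *\<^sub>R (f y * v y) = indicator {c..2} y *\<^sub>R (A * (1 / y))"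
        using t by (auto simp: f_def v_def indicator_def)
    qed
    also have "\<dots> = A * (LINT y:{c..2}|lebesgue. 1 / y)"
      by (rule set_integral_mult_right)
    also have "(LINT y:{c..2}|lebesgue. 1 / y) = enn2real (\<integral>\<^sup>+y\<in>{c..2}. ennreal (1 / y) \<partial>lebesgue)"
      unfolding set_lebesgue_integral_def
      by (subst integral_eq_nn_integral)
         (use c in \<open>auto intro!: borel_measurable_times borel_measurable_indicator measurable_completion
            arg_cong[where f = enn2real] nn_integral_cong simp: indicator_def\<close>)
    also have "\<dots> = B" using c B by (simp add: mass_reciprocal)
    finally show ?thesis using t by (simp add: hardy_steklov_def w_def)
  qed
  have AB: "A * B = B powr (1 / q)"
  proof -
    have "A * B = B powr (- 1 / p) * B powr 1" using B by (simp add: A_def)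
    also have "\<dots> = B powr (- 1 / p + 1)" by (rule powr_add[symmetric])
    also have "- 1 / p + 1 = 1 / q" using q(2) by (simp add: field_simps)
    finally show ?thesis .
  qed
  have w_mass: "(\<integral>\<^sup>+t. ennreal d * indicator {1..c} t \<partial>lebesgue) = ennreal (d * (c - 1))" if "0 \<le> d" for d
    using that c by (simp add: nn_integral_cmult_indicator flip: ennreal_mult)
  have lower: "ennreal ((c - 1) powr (1 / p) * B powr (1 / q)) \<le> Lp_norm p ?H"
  proof -
    have "ennreal ((B powr (1 / q)) powr p * (c - 1)) =
        (\<integral>\<^sup>+t. ennreal ((B powr (1 / q)) powr p) * indicator {1..c} t \<partial>lebesgue)"
      by (rule w_mass[symmetric]) simp
    also have "\<dots> \<le> (\<integral>\<^sup>+t\<in>{0..}. ennreal (\<bar>?H t\<bar> powr p) \<partial>lebesgue)"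
      using H AB by (intro nn_integral_mono) (auto simp: indicator_def)
    also have "\<dots> = (\<integral>\<^sup>+t. ennreal (\<bar>?H t\<bar> powr p) \<partial>half_line)"
      by (rule nn_integral_restrict_space[symmetric]) simp
    finally have "ennreal ((B powr (1 / q)) powr p * (c - 1)) \<le> (\<integral>\<^sup>+t. ennreal (\<bar>?H t\<bar> powr p) \<partial>half_line)" .
    then have "ennreal ((B powr (1 / q)) powr p * (c - 1)) epowr (1 / p) \<le> Lp_norm p ?H"
      unfolding Lp_norm_def by (rule epowr_mono[rotated]) (use p in simp)
    moreover have "((B powr (1 / q)) powr p * (c - 1)) powr (1 / p) = (c - 1) powr (1 / p) * B powr (1 / q)"
      using c p by (simp add: powr_mult powr_powr)
    ultimately show ?thesis using c by simp
  qed
  have upper: "\<mu> p v w (\<lambda>t. 1 * t) (\<lambda>t. 2 * t) x m \<le> ennreal ((c - 1) powr (1 / p) * (2 * B) powr (1 / q))" for m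
  proof -
    have "mass p w {x m..x (m + 1)} \<le> (\<integral>\<^sup>+t. ennreal 1 * indicator {1..c} t \<partial>lebesgue)"
      by (intro nn_integral_mono) (auto simp: w_def indicator_def)
    then have "mass p w {x m..x (m + 1)} \<le> ennreal (c - 1)" using w_mass[of 1] by simp
    then have W: "mass p w {x m..x (m + 1)} epowr (1 / p) \<le> ennreal ((c - 1) powr (1 / p))"
      using epowr_mono[of "1 / p" _ "ennreal (c - 1)"] p c by simp
    have "x m \<le> x (m + 1)" "0 < x m" by (auto simp: x_def)
    moreover have "ln (2 * x (m + 1) / (1 * x m)) = 2 * B"
      by (simp add: x_def B_def ln_div ln_mult ln_powr field_simps)
    ultimately have "mass q v {1 * x m..2 * x (m + 1)} = ennreal (2 * B)"
      using v_mass[of "1 * x m" "2 * x (m + 1)"] by simp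
    then have "\<mu> p v w (\<lambda>t. 1 * t) (\<lambda>t. 2 * t) x m =
        mass p w {x m..x (m + 1)} epowr (1 / p) * ennreal ((2 * B) powr (1 / q))"
      using B by (simp add: \<mu>_def flip: q_def)
    also have "\<dots> \<le> ennreal ((c - 1) powr (1 / p)) * ennreal ((2 * B) powr (1 / q))"
      by (intro mult_right_mono W) simp
    finally show ?thesis by (simp flip: ennreal_mult)
  qed
  have "0 \<le> \<gamma>" using \<gamma> by (simp add: norm_constant_def)
  have "Lp_norm p ?H \<le> op_norm p (hardy_steklov v w (\<lambda>t. 1 * t) (\<lambda>t. 2 * t))"
    unfolding op_norm_def using f_Lp by (intro SUP_upper) auto
  also have "\<dots> \<le> ennreal \<gamma> * (SUP m. \<mu> p v w (\<lambda>t. 1 * t) (\<lambda>t. 2 * t) x m)"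
    using \<gamma> model_setting model_partition unfolding norm_constant_def by blast
  also have "\<dots> \<le> ennreal \<gamma> * ennreal ((c - 1) powr (1 / p) * (2 * B) powr (1 / q))"
    by (intro mult_left_mono SUP_least upper) simp
  finally have "ennreal ((c - 1) powr (1 / p) * B powr (1 / q))
      \<le> ennreal (\<gamma> * ((c - 1) powr (1 / p) * (2 * B) powr (1 / q)))"
    using lower \<open>0 \<le> \<gamma>\<close> by (simp add: ennreal_mult' order_trans)
  then have "(c - 1) powr (1 / p) * B powr (1 / q) \<le> \<gamma> * ((c - 1) powr (1 / p) * (2 * B) powr (1 / q))"
    using \<open>0 \<le> \<gamma>\<close> by simp
  also have "\<dots> = (\<gamma> * 2 powr (1 / q)) * ((c - 1) powr (1 / p) * B powr (1 / q))"
    using B by (simp add: powr_mult)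
  finally have "1 \<le> \<gamma> * 2 powr (1 / q)" using B c by simp
  also have "\<dots> \<le> \<gamma> * 2"
    using \<open>0 \<le> \<gamma>\<close> q powr_mono[of "1 / q" 1 2] by (intro mult_left_mono) auto
  finally show ?thesis by simp
qed

end

section \<open>Approximation below a threshold\<close>

text \<open>The pieces of a monotone grid do not overlap.  Applied to \<open>a \<circ> x\<close> and \<open>b \<circ> x\<close>, this bounds
  the interaction of the errors made on different intervals.\<close>
lemma sum_mass_grid_le:
  fixes g :: "int \<Rightarrow> real" and u :: "real \<Rightarrow> real"
  assumes "mono g" "finite T" and u: "u \<in> borel_measurable lebesgue"
  shows "(\<Sum>m\<in>T. mass r u {g m<..g (m + 1)}) \<le> mass r u UNIV"
proof -
  have disj: "disjoint_family_on (\<lambda>m. {g m<..g (m + 1)}) T"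
    unfolding disjoint_family_on_def
  proof (intro ballI impI)
    have *: "{g m<..g (m + 1)} \<inter> {g m'<..g (m' + 1)} = {}" if "m < m'" for m m' :: int
      using monoD[OF \<open>mono g\<close>, of "m + 1" m'] that by auto
    fix m m' :: int assume "m \<noteq> m'"
    then show "{g m<..g (m + 1)} \<inter> {g m'<..g (m' + 1)} = {}"
      using *[of m m'] *[of m' m] by (cases "m < m'") auto
  qed
  have [measurable]: "u \<in> borel_measurable lebesgue" by fact
  have "(\<Sum>m\<in>T. mass r u {g m<..g (m + 1)}) =
      (\<integral>\<^sup>+y. (\<Sum>m\<in>T. ennreal (u y powr r) * indicator {g m<..g (m + 1)} y) \<partial>lebesgue)"
    by (intro nn_integral_sum[symmetric] borel_measurable_times_ennreal borel_measurable_indicator) auto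
  also have "\<dots> = mass r u (\<Union>m\<in>T. {g m<..g (m + 1)})"
    by (simp add: indicator_UN_disjoint[OF \<open>finite T\<close> disj] flip: sum_distrib_left)
  also have "\<dots> \<le> mass r u UNIV" by (rule mass_subset) simp
  finally show ?thesis .
qed

lemma mass_le_cover:
  fixes u :: "real \<Rightarrow> real"
  assumes "finite T" "A \<subseteq> U \<union> (\<Union>m\<in>T. B m)" "u \<in> borel_measurable lebesgue"
    and "U \<in> sets lebesgue" "\<And>m. m \<in> T \<Longrightarrow> B m \<in> sets lebesgue"
  shows "mass r u A \<le> mass r u U + (\<Sum>m\<in>T. mass r u (B m))"
proof -
  have [measurable]: "u \<in> borel_measurable lebesgue" by fact
  have "mass r u A \<le> (\<integral>\<^sup>+y. ennreal (u y powr r) * indicator U y +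
      (\<Sum>m\<in>T. ennreal (u y powr r) * indicator (B m) y) \<partial>lebesgue)"
  proof (rule nn_integral_mono)
    fix y
    have "indicator A y \<le> indicator U y + (\<Sum>m\<in>T. indicator (B m) y :: ennreal)"
    proof (cases "y \<in> A \<and> y \<notin> U")
      case True
      then obtain m where "m \<in> T" "y \<in> B m" using assms(2) by auto
      then have "(1::ennreal) \<le> (\<Sum>m\<in>T. indicator (B m) y)"
        using member_le_sum[of m T "\<lambda>m. indicator (B m) y :: ennreal"] assms(1) by simp
      then show ?thesis using True by simp
    qed (auto simp: indicator_def)
    then have "ennreal (u y powr r) * indicator A y \<le>
        ennreal (u y powr r) * (indicator U y + (\<Sum>m\<in>T. indicator (B m) y))"
      by (rule mult_left_mono) simp
    then show "ennreal (u y powr r) * indicator A y \<le> ennreal (u y powr r) * indicator U y +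
      (\<Sum>m\<in>T. ennreal (u y powr r) * indicator (B m) y)"
      by (simp add: distrib_left sum_distrib_left)
  qed
  also have "\<dots> = mass r u U + (\<Sum>m\<in>T. mass r u (B m))"
  proof -
    have m: "(\<lambda>y. ennreal (u y powr r) * indicator X y) \<in> borel_measurable lebesgue"
      if "X \<in> sets lebesgue" for X
      by (intro borel_measurable_times_ennreal borel_measurable_indicator that) auto
    show ?thesis
      using m[OF assms(4)] m[OF assms(5)]
      by (subst nn_integral_add) (auto intro!: borel_measurable_sum nn_integral_sum)
  qed
  finally show ?thesis .
qed

text \<open>
  Restricting \<open>w\<close> to a set \<open>U\<close> changes neither the fairway nor the partition points, so the norm
  estimate still refers to the same intervals, and those disjoint from \<open>U\<close> drop out of its
  supremum.  The left endpoint is excluded in the intersection because single points are null.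
\<close>
lemma restricted_weight_norm:
  assumes p: "1 < p" and set: "hs_setting p v w a b \<sigma>" and x: "partition_points a b \<sigma> x"
    and \<gamma>: "norm_constant p \<gamma>"
    and U: "U \<in> sets borel" and c: "0 \<le> c"
    and dich: "\<And>m. U \<inter> {x m<..x (m + 1)} = {} \<or> \<mu> p v w a b x m \<le> ennreal c"
  shows "op_norm p (hardy_steklov v (\<lambda>t. indicator U t * w t) a b) \<le> ennreal (\<gamma> * c)"
proof -
  let ?wU = "\<lambda>t. indicator U t * w t"
  have mass_le: "mass p ?wU A \<le> mass p w A" for A
    by (intro nn_integral_mono) (auto simp: indicator_def)
  have "weight_on p w" using set by (simp add: hs_setting_def)
  have "weight_on p ?wU"
    unfolding weight_on_def
  proof (intro conjI allI impI)
    have "(indicator U :: real \<Rightarrow> real) \<in> borel_measurable half_line"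
      using U by (intro borel_measurable_half_lineI borel_measurable_indicator)
    then show "?wU \<in> borel_measurable half_line"
      using \<open>weight_on p w\<close> by (intro borel_measurable_times) (auto simp: weight_on_def)
    show "0 \<le> ?wU y" if "0 \<le> y" for y using \<open>weight_on p w\<close> that by (simp add: weight_on_def)
    show "mass p ?wU C < top" if "compact C \<and> C \<subseteq> {0<..}" for C
      using mass_le[of C] \<open>weight_on p w\<close> that by (auto simp: weight_on_def intro: le_less_trans)
  qed
  then have "hs_setting p v ?wU a b \<sigma>" using set by (simp add: hs_setting_def)
  then have "op_norm p (hardy_steklov v ?wU a b) \<le> ennreal \<gamma> * (SUP m. \<mu> p v ?wU a b x m)"
    using \<gamma> x by (auto simp: norm_constant_def)
  also have "\<dots> \<le> ennreal \<gamma> * ennreal c"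
  proof (intro mult_left_mono SUP_least)
    fix m
    show "\<mu> p v ?wU a b x m \<le> ennreal c"
    proof (cases "U \<inter> {x m<..x (m + 1)} = {}")
      case True
      have "mass p ?wU {x m..x (m + 1)} = (\<integral>\<^sup>+t. 0 \<partial>(lebesgue :: real measure))"
      proof (rule nn_integral_cong_AE)
        have "AE t in lebesgue. t \<noteq> x m" by (rule AE_I[of _ _ "{x m}"]) auto
        then show "AE t in lebesgue. ennreal (?wU t powr p) * indicator {x m..x (m + 1)} t = 0"
          by eventually_elim (use True in \<open>auto simp: indicator_def\<close>)
      qed
      then show ?thesis by (simp add: \<mu>_def epowr_def)
    next
      case False
      have "\<mu> p v ?wU a b x m \<le> \<mu> p v w a b x m"
        unfolding \<mu>_def using p by (intro mult_right_mono epowr_mono mass_le) auto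
      then show ?thesis using dich[of m] False by (auto intro: order_trans)
    qed
  qed simp
  also have "\<dots> = ennreal (\<gamma> * c)" using c \<gamma> by (simp add: norm_constant_def ennreal_mult)
  finally show ?thesis .
qed

text \<open>
  \<open>S\<close> lists the units of rank to be spent: \<open>(m, j) \<in> S\<close> says that \<open>I\<^sub>m\<close> receives at least \<open>j + 1\<close>
  of them.  With \<open>n\<^sub>m\<close> units on \<open>I\<^sub>m\<close>, \<open>2\<gamma>\<mu>\<^sub>m \<le> (n\<^sub>m + 1) t\<close>.  Where \<open>n\<^sub>m = 0\<close> the norm
  estimate yields an error of at most \<open>t/2\<close>; elsewhere freezing yields at most
  \<open>\<mu>\<^sub>m / (2 n\<^sub>m) \<le> \<mu>\<^sub>m / (n\<^sub>m + 1) \<le> t / (2\<gamma>) \<le> t\<close>, relative to the part of \<open>f\<close> on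
  \<open>a(I\<^sub>m)\<close> and \<open>b(I\<^sub>m)\<close>.
\<close>
lemma approx_number_threshold:
  fixes p \<gamma> t :: real and v w a b \<sigma> :: "real \<Rightarrow> real" and x :: "int \<Rightarrow> real"
  assumes p: "1 < p" and set: "hs_setting p v w a b \<sigma>" and x: "partition_points a b \<sigma> x"
    and \<gamma>: "norm_constant p \<gamma>" and t: "0 < t"
  defines "S \<equiv> {(m, j :: nat). t < 2 * \<gamma> * enn2real (\<mu> p v w a b x m) / real (Suc j)}"
  assumes fin: "finite S"
  shows "approx_number p (hardy_steklov v w a b) (Suc (card S)) \<le> ennreal (7 powr (1 / p) * t)"
proof -
  define q where "q = conj_exp p"
  have pq: "1 < p" "1 < q" "1 / p + 1 / q = 1"
    using p by (auto simp: q_def conj_exp_def field_simps)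
  have ab: "boundaries a b" and v: "v \<in> borel_measurable half_line" "\<forall>x\<ge>0. 0 \<le> v x"
    and w: "w \<in> borel_measurable half_line" "\<forall>x\<ge>0. 0 \<le> w x"
    and v_loc: "\<And>C. compact C \<Longrightarrow> C \<subseteq> {0<..} \<Longrightarrow> mass q v C < top"
    using set by (auto simp: hs_setting_def weight_on_def q_def)
  have bf: "boundary_function a" "boundary_function b" using ab by (auto simp: boundaries_def)
  note A = boundary_functionD[OF bf(1)] and B = boundary_functionD[OF bf(2)]
  note x_pos = partition_points_bounds(1)[OF ab x] and x_step = partition_points_bounds(2)[OF ab x]
    and x_ab = partition_points_bounds(3)[OF ab x]
  have "strict_mono x" using x by (simp add: partition_points_def)
  then have "mono x" by (rule strict_mono_mono)
  have half: "1 / 2 \<le> \<gamma>" by (rule norm_constant_ge_half[OF p \<gamma>])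
  define M where "M m = enn2real (\<mu> p v w a b x m)" for m
  have M0: "0 \<le> M m" for m by (simp add: M_def)
  have \<mu>_M: "\<mu> p v w a b x m = ennreal (M m)" for m by (simp add: M_def \<mu>_finite(3)[OF p set x])
  define J where "J m = {j :: nat. t < 2 * \<gamma> * M m / real (Suc j)}" for m
  define n where "n m = card (J m)" for m
  define T where "T = fst ` S"
  have S_eq: "S = Sigma T J" by (force simp: S_def T_def J_def M_def)
  have "finite T" using fin by (simp add: T_def)
  have J_fin: "finite (J m)" for m
  proof -
    have "J m = Pair m -` S" by (auto simp: S_def J_def M_def)
    then show ?thesis using fin by (simp add: finite_vimageI inj_on_def)
  qed
  have J_T: "m \<in> T \<longleftrightarrow> J m \<noteq> {}" for m by (force simp: S_def T_def J_def M_def)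
  have n_pos: "0 < n m" if "m \<in> T" for m
    using that J_T[of m] J_fin[of m] by (simp add: n_def card_gt_0_iff)
  \<comment> \<open>\<open>J m\<close> is an initial segment of the natural numbers, so its first missing element is its
    cardinality.\<close>
  have M_le: "2 * \<gamma> * M m \<le> t * real (Suc (n m))" for m
  proof (rule ccontr)
    assume "\<not> 2 * \<gamma> * M m \<le> t * real (Suc (n m))"
    then have big: "t * real (Suc (n m)) < 2 * \<gamma> * M m" by simp
    have "{..n m} \<subseteq> J m"
    proof
      fix j assume "j \<in> {..n m}"
      then have "t * real (Suc j) \<le> t * real (Suc (n m))" using t by (intro mult_left_mono) auto
      then have "t * real (Suc j) < 2 * \<gamma> * M m" using big by simp
      then show "j \<in> J m" by (simp add: J_def less_divide_eq)
    qed
    then have "card {..n m} \<le> card (J m)" by (intro card_mono J_fin)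
    then show False by (simp add: n_def)
  qed
  define Q where "Q = Sigma T (\<lambda>m. {..<n m})"
  have "finite Q" using \<open>finite T\<close> by (simp add: Q_def)
  have card_Q: "card Q = card S"
    unfolding S_eq Q_def using \<open>finite T\<close> J_fin by (simp add: n_def)
  define I where "I m = {x m<..x (m + 1)}" for m
  let ?fr = "\<lambda>f D. LINT y:D|lebesgue. ext0 f y * ext0 v y"
  \<comment> \<open>the outcome of freezing the boundaries on \<open>I m\<close>, as a predicate, so that the choices for
    all \<open>m\<close> can be made at once\<close>
  define good where "good m P z \<longleftrightarrow> (\<forall>i<n m. P i \<in> sets borel \<and> P i \<subseteq> I m \<and> z i \<in> {x m..x (m + 1)}) \<and>
      (\<forall>f. f \<in> Lp p \<longrightarrow>
        mass p (\<lambda>s. \<bar>ext0 w s * ?fr f {a s..b s}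
            - (\<Sum>i<n m. (indicator (P i) s * ext0 w s) * ?fr f {a (z i)<..b (z i)})\<bar>) (I m)
        \<le> ennreal ((M m / (2 * n m)) powr p)
            * (mass p (\<lambda>y. \<bar>ext0 f y\<bar>) {a (x m)<..a (x (m + 1))} + mass p (\<lambda>y. \<bar>ext0 f y\<bar>) {b (x m)<..b (x (m + 1))}))" for m P z
  have "\<exists>P z. good m P z"
    if m: "m \<in> T" for m
  proof -
    define Wm where "Wm = enn2real (mass p w {x m..x (m + 1)})"
    define Vm where "Vm = enn2real (mass q v {a (x m)..b (x (m + 1))})"
    have sub: "{x m..x (m + 1)} \<subseteq> {0<..}" using x_pos[of m] by auto
    have "0 < a (x m)" using A(3) x_pos by simp
    have W: "mass p (ext0 w) {x m..x (m + 1)} = ennreal Wm"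
      using \<mu>_finite(1)[OF p set x, of m] sub by (subst mass_ext0) (auto simp: Wm_def)
    have V: "mass q (ext0 v) {a (x m)..b (x (m + 1))} = ennreal Vm"
      using \<mu>_finite(2)[OF p set x, of m] \<open>0 < a (x m)\<close> by (subst mass_ext0) (auto simp: Vm_def q_def)
    have M_eq: "M m = Wm powr (1 / p) * Vm powr (1 / q)"
      by (simp add: M_def \<mu>_finite(3)[OF p set x] Wm_def Vm_def q_def)
    obtain P z where "\<And>i. i < n m \<Longrightarrow> P i \<in> sets borel" "\<And>i. i < n m \<Longrightarrow> P i \<subseteq> {x m<..x (m + 1)}"
      "\<And>i. i < n m \<Longrightarrow> z i \<in> {x m..x (m + 1)}"
      "\<And>f. f \<in> borel_measurable lebesgue \<Longrightarrow> mass p (\<lambda>y. \<bar>f y\<bar>) UNIV < top \<Longrightarrow>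
        mass p (\<lambda>s. \<bar>ext0 w s * (LINT y:{a s..b s}|lebesgue. f y * ext0 v y)
          - (\<Sum>i<n m. (indicator (P i) s * ext0 w s) * (LINT y:{a (z i)<..b (z i)}|lebesgue. f y * ext0 v y))\<bar>) {x m<..x (m + 1)}
        \<le> ennreal ((Wm powr (1 / p) * Vm powr (1 / q) / (2 * n m)) powr p)
          * (mass p (\<lambda>y. \<bar>f y\<bar>) {a (x m)<..a (x (m + 1))} + mass p (\<lambda>y. \<bar>f y\<bar>) {b (x m)<..b (x (m + 1))})"
    proof (rule freeze_boundaries[of p q "ext0 w" "ext0 v" "x m" "x (m + 1)" a b Wm Vm "n m"])
      show "continuous_on {x m..x (m + 1)} a" "continuous_on {x m..x (m + 1)} b"
        using continuous_on_subset[OF A(1) sub] continuous_on_subset[OF B(1) sub] by auto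
      show "strict_mono_on {x m..x (m + 1)} a" "strict_mono_on {x m..x (m + 1)} b"
        using A(2) B(2) sub by (blast intro: monotone_on_subset)+
      show "x m \<le> x (m + 1)" using x_step[of m] by simp
    qed (use pq ext0_measurable[OF v(1)] ext0_measurable[OF w(1)] ext0_nonneg[OF v(2)] ext0_nonneg[OF w(2)]
        x_ab[of m] W V n_pos[OF m] in \<open>auto simp: Wm_def Vm_def\<close>)
    then show ?thesis
      unfolding good_def M_eq I_def using Lp_ext0 by (intro exI[of _ P] exI[of _ z]) blast
  qed
  then obtain P z where good: "\<And>m. m \<in> T \<Longrightarrow> good m (P m) (z m)" by metis
  then have P: "\<And>m i. m \<in> T \<Longrightarrow> i < n m \<Longrightarrow> P m i \<in> sets borel"
      "\<And>m i. m \<in> T \<Longrightarrow> i < n m \<Longrightarrow> P m i \<subseteq> I m"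
    and z: "\<And>m i. m \<in> T \<Longrightarrow> i < n m \<Longrightarrow> z m i \<in> {x m..x (m + 1)}"
    and local: "\<And>m f. m \<in> T \<Longrightarrow> f \<in> Lp p \<Longrightarrow>
        mass p (\<lambda>s. \<bar>ext0 w s * ?fr f {a s..b s}
            - (\<Sum>i<n m. (indicator (P m i) s * ext0 w s) * ?fr f {a (z m i)<..b (z m i)})\<bar>) (I m)
        \<le> ennreal ((M m / (2 * n m)) powr p)
            * (mass p (\<lambda>y. \<bar>ext0 f y\<bar>) {a (x m)<..a (x (m + 1))} + mass p (\<lambda>y. \<bar>ext0 f y\<bar>) {b (x m)<..b (x (m + 1))})"
    unfolding good_def by blast+
  define e where "e r s = indicator (P (fst r) (snd r)) s * w s" for r s
  define D where "D r = {a (z (fst r) (snd r))<..b (z (fst r) (snd r))}" for r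
  define K where "K f s = (\<Sum>r\<in>Q. e r s * (LINT y:D r|lebesgue. f y * v y))" for f s
  have Q_D: "z (fst r) (snd r) > 0" "P (fst r) (snd r) \<in> sets borel" "P (fst r) (snd r) \<subseteq> I (fst r)" if "r \<in> Q" for r
    using that P[of "fst r" "snd r"] z[of "fst r" "snd r"] x_pos[of "fst r"] by (auto simp: Q_def)
  have e_Lp: "e r \<in> Lp p" if r: "r \<in> Q" for r
    unfolding Lp_def Lp_norm_finite_iff
  proof (intro CollectI conjI)
    have "(indicator (P (fst r) (snd r)) :: real \<Rightarrow> real) \<in> borel_measurable half_line"
      using Q_D[OF r] by (intro borel_measurable_half_lineI borel_measurable_indicator)
    then show "e r \<in> borel_measurable half_line"
      unfolding e_def using w(1) by (intro borel_measurable_times)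
    have "(\<integral>\<^sup>+s. ennreal (\<bar>e r s\<bar> powr p) \<partial>half_line) \<le> mass p w {x (fst r)..x (fst r + 1)}"
      using Q_D[OF r] w(2)
      by (subst nn_integral_restrict_space) (auto intro!: nn_integral_mono simp: indicator_def e_def I_def)
    also have "\<dots> < top" by (rule \<mu>_finite(1)[OF p set x])
    finally show "(\<integral>\<^sup>+s. ennreal (\<bar>e r s\<bar> powr p) \<partial>half_line) < top" .
  qed
  have D_fin: "mass q v (D r) < top" and D_sub: "D r \<subseteq> {0..}" if "r \<in> Q" for r
  proof -
    have "0 < a (z (fst r) (snd r))" using A(3) Q_D(1)[OF that] by simp
    then have "mass q v (D r) \<le> mass q v {a (z (fst r) (snd r))..b (z (fst r) (snd r))}"
       "mass q v {a (z (fst r) (snd r))..b (z (fst r) (snd r))} < top" "D r \<subseteq> {0..}"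
      by (auto simp: D_def intro!: mass_subset v_loc)
    then show "mass q v (D r) < top" "D r \<subseteq> {0..}" by auto
  qed
  have K_op: "Lp_operator p K" "Lp_rank p K \<le> enat (card S)"
    using finite_rank_operator[OF pq v \<open>finite Q\<close>, of e D] e_Lp D_fin D_sub card_Q
    unfolding K_def[abs_def] by (auto simp: D_def)
  \<comment> \<open>the part of the half-line on which \<open>K\<close> vanishes\<close>
  define U where "U = {0<..} - (\<Union>m\<in>T. I m)"
  have U: "U \<in> sets borel" using \<open>finite T\<close> by (auto simp: U_def I_def)
  have untouched: "op_norm p (hardy_steklov v (\<lambda>t. indicator U t * w t) a b) \<le> ennreal (t / 2)"
  proof -
    have "op_norm p (hardy_steklov v (\<lambda>t. indicator U t * w t) a b) \<le> ennreal (\<gamma> * (t / (2 * \<gamma>)))"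
    proof (rule restricted_weight_norm[OF p set x \<gamma> U])
      fix m
      show "U \<inter> {x m<..x (m + 1)} = {} \<or> \<mu> p v w a b x m \<le> ennreal (t / (2 * \<gamma>))"
      proof (cases "m \<in> T")
        case True
        then show ?thesis by (auto simp: U_def I_def)
      next
        case False
        then have "n m = 0" using J_T by (simp add: n_def)
        then have "M m \<le> t / (2 * \<gamma>)" using M_le[of m] half by (simp add: field_simps)
        then show ?thesis by (simp add: \<mu>_M ennreal_leI)
      qed
    qed (use t half in auto)
    also have "\<gamma> * (t / (2 * \<gamma>)) = t / 2" using half by simp
    finally show ?thesis .
  qed
  show ?thesis
  proof (rule approx_number_le[OF K_op p])
    fix f assume f: "f \<in> Lp p" "Lp_norm p f \<le> 1"
    let ?H = "hardy_steklov v w a b f"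
    have f_le: "mass p (\<lambda>y. \<bar>ext0 f y\<bar>) UNIV \<le> 1"
      using f(2) Lp_norm_le_iff[of p 1 f] p by (simp add: nn_integral_half_line_ext0)
    define err where "err s = (if s \<in> {0<..} then ?H s - K f s else 0)" for s
    have err_meas: "err \<in> borel_measurable lebesgue"
    proof -
      have "set_integrable lebesgue {c..d} (\<lambda>y. f y * v y)" if "0 < c" "c \<le> d" for c d
        using that by (intro Lp_set_integrable[OF pq f(1) v]) (auto intro: v_loc)
      then have "continuous_on {0<..} (\<lambda>s. LINT y:{a s..b s}|lebesgue. f y * v y)"
        by (rule continuous_on_window_integral[OF ab])
      then have "(\<lambda>s. LINT y:{a s..b s}|lebesgue. f y * v y) \<in> borel_measurable (lebesgue_on {0<..})"
        by (rule continuous_imp_measurable_on_sets_lebesgue) simp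
      moreover have "w \<in> borel_measurable (lebesgue_on {0<..})"
        by (rule measurable_restrict_mono[OF w(1)]) auto
      moreover have "K f \<in> borel_measurable (lebesgue_on {0<..})"
      proof (rule measurable_restrict_mono)
        have "K f \<in> Lp p" using K_op(1) f(1) unfolding Lp_operator_def by blast
        then show "K f \<in> borel_measurable half_line" by (simp add: Lp_def)
      qed auto
      ultimately have "(\<lambda>s. ?H s - K f s) \<in> borel_measurable (lebesgue_on {0<..})"
        unfolding hardy_steklov_def by (intro borel_measurable_diff borel_measurable_times)
      from borel_measurable_if_I[OF this] show ?thesis by (simp add: err_def[abs_def])
    qed
    have on_U: "mass p (\<lambda>s. \<bar>err s\<bar>) U \<le> ennreal ((t / 2) powr p)"
    proof -
      have K0: "K f s = 0" if "s \<in> U" for s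
        unfolding K_def
      proof (rule sum.neutral, rule ballI)
        fix r assume r: "r \<in> Q"
        then have "s \<notin> P (fst r) (snd r)" using Q_D(3)[OF r] that by (auto simp: U_def Q_def)
        then show "e r s * (LINT y:D r|lebesgue. f y * v y) = 0" by (simp add: e_def)
      qed
      have "mass p (\<lambda>s. \<bar>err s\<bar>) U \<le>
          (\<integral>\<^sup>+s. ennreal (\<bar>hardy_steklov v (\<lambda>t. indicator U t * w t) a b f s\<bar> powr p) \<partial>half_line)"
        unfolding nn_integral_half_line
      proof (rule nn_integral_mono)
        fix s :: real
        show "ennreal (\<bar>err s\<bar> powr p) * indicator U s \<le>
            ennreal (\<bar>hardy_steklov v (\<lambda>t. indicator U t * w t) a b f s\<bar> powr p) * indicator {0<..} s"
        proof (cases "s \<in> U")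
          case True
          then have "0 < s" by (simp add: U_def)
          then show ?thesis using True K0[OF True] by (simp add: err_def hardy_steklov_def)
        qed simp
      qed
      also have "\<dots> \<le> ennreal ((t / 2) powr p)"
      proof -
        have "Lp_norm p (hardy_steklov v (\<lambda>t. indicator U t * w t) a b f) \<le> ennreal (t / 2)"
          by (rule order_trans[OF _ untouched], unfold op_norm_def, rule SUP_upper) (use f in simp)
        then show ?thesis using Lp_norm_le_iff[of p "t / 2"] p t by simp
      qed
      finally show ?thesis .
    qed
    have on_I: "mass p (\<lambda>s. \<bar>err s\<bar>) (I m) \<le> ennreal (t powr p) *
        (mass p (\<lambda>y. \<bar>ext0 f y\<bar>) {a (x m)<..a (x (m + 1))} + mass p (\<lambda>y. \<bar>ext0 f y\<bar>) {b (x m)<..b (x (m + 1))})"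
      if m: "m \<in> T" for m
    proof -
      have err_eq: "err s = ext0 w s * ?fr f {a s..b s}
            - (\<Sum>i<n m. (indicator (P m i) s * ext0 w s) * ?fr f {a (z m i)<..b (z m i)})"
        if s: "s \<in> I m" for s
      proof -
        have s0: "0 < s" using s x_pos[of m] by (simp add: I_def)
        have other: "s \<notin> I m'" if "m' \<noteq> m" for m'
          using s that monoD[OF \<open>mono x\<close>, of "m + 1" m'] monoD[OF \<open>mono x\<close>, of "m' + 1" m]
          by (cases "m < m'") (auto simp: I_def)
        have "K f s = (\<Sum>m'\<in>T. \<Sum>i<n m'. e (m', i) s * (LINT y:D (m', i)|lebesgue. f y * v y))"
          unfolding K_def Q_def using \<open>finite T\<close> by (subst sum.Sigma) (auto simp: case_prod_beta)
        also have "\<dots> = (\<Sum>m'\<in>T. if m' = m then \<Sum>i<n m. e (m, i) s * (LINT y:D (m, i)|lebesgue. f y * v y) else 0)"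
        proof (intro sum.cong refl)
          fix m' assume m': "m' \<in> T"
          show "(\<Sum>i<n m'. e (m', i) s * (LINT y:D (m', i)|lebesgue. f y * v y)) =
              (if m' = m then \<Sum>i<n m. e (m, i) s * (LINT y:D (m, i)|lebesgue. f y * v y) else 0)"
          proof (cases "m' = m")
            case False
            have "e (m', i) s = 0" if "i < n m'" for i
              using P(2)[OF m' that] other[OF False] by (auto simp: e_def indicator_def)
            then show ?thesis using False by simp
          qed simp
        qed
        also have "\<dots> = (\<Sum>i<n m. e (m, i) s * (LINT y:D (m, i)|lebesgue. f y * v y))"
          using m \<open>finite T\<close> by simp
        also have "\<dots> = (\<Sum>i<n m. (indicator (P m i) s * ext0 w s) * ?fr f {a (z m i)<..b (z m i)})"
        proof (intro sum.cong refl)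
          fix i assume "i \<in> {..<n m}"
          then have "(m, i) \<in> Q" using m by (simp add: Q_def)
          from set_integral_ext0[OF D_sub[OF this], of f v] s0
          show "e (m, i) s * (LINT y:D (m, i)|lebesgue. f y * v y) =
              (indicator (P m i) s * ext0 w s) * ?fr f {a (z m i)<..b (z m i)}"
            by (simp add: e_def D_def)
        qed
        finally have "K f s = \<dots>" .
        moreover have "?fr f {a s..b s} = (LINT y:{a s..b s}|lebesgue. f y * v y)"
          using A(3)[OF s0] by (intro set_integral_ext0) auto
        ultimately show ?thesis using s0 by (simp add: err_def hardy_steklov_def)
      qed
      have "mass p (\<lambda>s. \<bar>err s\<bar>) (I m) = mass p (\<lambda>s. \<bar>ext0 w s * ?fr f {a s..b s}
            - (\<Sum>i<n m. (indicator (P m i) s * ext0 w s) * ?fr f {a (z m i)<..b (z m i)})\<bar>) (I m)"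
        by (intro nn_integral_cong) (simp add: err_eq indicator_def)
      also note local[OF m f(1)]
      also have "ennreal ((M m / (2 * n m)) powr p) \<le> ennreal (t powr p)"
      proof (intro ennreal_leI powr_mono2)
        have "M m \<le> 2 * \<gamma> * M m" using half M0[of m] mult_right_mono[of 1 "2 * \<gamma>" "M m"] by simp
        also have "\<dots> \<le> t * real (Suc (n m))" by (rule M_le)
        also have "\<dots> \<le> t * real (2 * n m)" using n_pos[OF m] t by (intro mult_left_mono) auto
        finally show "M m / (2 * n m) \<le> t" using n_pos[OF m] by (simp add: field_simps)
      qed (use p M0 in auto)
      finally show ?thesis by (simp add: mult_right_mono)
    qed
    have mono_ax: "mono (\<lambda>m. a (x m))" "mono (\<lambda>m. b (x m))"
      using x_pos \<open>mono x\<close> by (auto simp: mono_def intro!: strict_mono_on_leD[OF A(2)] strict_mono_on_leD[OF B(2)])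
    have f_meas: "(\<lambda>y. \<bar>ext0 f y\<bar>) \<in> borel_measurable lebesgue" using Lp_ext0(1)[OF f(1)] by simp
    have "(\<integral>\<^sup>+s. ennreal (\<bar>?H s - K f s\<bar> powr p) \<partial>half_line) = mass p (\<lambda>s. \<bar>err s\<bar>) {0<..}"
      unfolding nn_integral_half_line by (intro nn_integral_cong) (auto simp: indicator_def err_def)
    also have "\<dots> \<le> mass p (\<lambda>s. \<bar>err s\<bar>) U + (\<Sum>m\<in>T. mass p (\<lambda>s. \<bar>err s\<bar>) (I m))"
      using err_meas \<open>finite T\<close> U by (intro mass_le_cover) (auto simp: U_def I_def)
    also have "\<dots> \<le> ennreal ((t / 2) powr p) + (\<Sum>m\<in>T. ennreal (t powr p) *
        (mass p (\<lambda>y. \<bar>ext0 f y\<bar>) {a (x m)<..a (x (m + 1))} + mass p (\<lambda>y. \<bar>ext0 f y\<bar>) {b (x m)<..b (x (m + 1))}))"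
      by (intro add_mono sum_mono on_U on_I)
    also have "\<dots> = ennreal ((t / 2) powr p) + ennreal (t powr p) *
        ((\<Sum>m\<in>T. mass p (\<lambda>y. \<bar>ext0 f y\<bar>) {a (x m)<..a (x (m + 1))}) +
         (\<Sum>m\<in>T. mass p (\<lambda>y. \<bar>ext0 f y\<bar>) {b (x m)<..b (x (m + 1))}))"
      by (simp add: sum_distrib_left sum.distrib distrib_left)
    \<comment> \<open>one contribution from \<open>U\<close>, one from the images under \<open>a\<close> and one from those under \<open>b\<close>\<close>
    also have "\<dots> \<le> ennreal (t powr p) + ennreal (t powr p) * (1 + 1)"
      using t p f_le
      by (intro add_mono mult_left_mono ennreal_leI powr_mono2
          order_trans[OF sum_mass_grid_le[OF mono_ax(1) \<open>finite T\<close> f_meas]]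
          order_trans[OF sum_mass_grid_le[OF mono_ax(2) \<open>finite T\<close> f_meas]]) auto
    also have "\<dots> = ennreal (3 * t powr p)"
    proof -
      have "ennreal (t powr p) * (1 + 1) = ennreal (2 * t powr p)"
        by (simp add: ennreal_mult' mult.commute)
      then show ?thesis by (simp flip: ennreal_plus)
    qed
    also have "\<dots> \<le> ennreal ((7 powr (1 / p) * t) powr p)"
      using p t by (intro ennreal_leI) (simp add: powr_mult powr_powr)
    finally show "(\<integral>\<^sup>+s. ennreal (\<bar>?H s - K f s\<bar> powr p) \<partial>half_line) \<le> ennreal ((7 powr (1 / p) * t) powr p)" .
  qed (use t in auto)
qed

section \<open>Summation over all thresholds\<close>

lemma suminf_zeta:
  assumes "1 < \<alpha>"
  shows "(\<Sum>j. ennreal (1 / real (Suc j) powr \<alpha>)) = ennreal (zeta_real \<alpha>)" "0 \<le> zeta_real \<alpha>"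
proof -
  have "summable (\<lambda>j. real j powr - \<alpha>)" using assms by (simp add: summable_real_powr_iff)
  then have "summable (\<lambda>j. real (Suc j) powr - \<alpha>)" by (rule summable_Suc_iff[THEN iffD2])
  then have "summable (\<lambda>j. 1 / real (Suc j) powr \<alpha>)" by (simp add: powr_minus_divide)
  then show "(\<Sum>j. ennreal (1 / real (Suc j) powr \<alpha>)) = ennreal (zeta_real \<alpha>)" "0 \<le> zeta_real \<alpha>"
    unfolding zeta_real_def by (auto intro!: suminf_ennreal2 suminf_nonneg)
qed

text \<open>The numbers \<open>C (m, j)\<close> below are the \<open>\<alpha>\<close>-th powers of \<open>7\<^sup>1\<^sup>/\<^sup>p 2\<gamma>\<mu>\<^sub>m / (j + 1)\<close>; the level \<open>t\<close>
  for them corresponds to the threshold \<open>u\<close> with \<open>7\<^sup>1\<^sup>/\<^sup>p u = t\<^sup>1\<^sup>/\<^sup>\<alpha>\<close>.\<close>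
theorem theorem2p9:
  fixes p \<alpha> \<gamma> :: real and v w a b \<sigma> :: "real \<Rightarrow> real" and x :: "int \<Rightarrow> real"
  assumes "1 < p" and "1 < \<alpha>"
    and "hs_setting p v w a b \<sigma>"
    and "partition_points a b \<sigma> x"
    and "norm_constant p \<gamma>"
  shows "(\<Sum>n. approx_number p (hardy_steklov v w a b) (Suc n) epowr \<alpha>)
    \<le> ennreal (2 powr \<alpha> * zeta_real \<alpha> * 7 powr (\<alpha> / p) * \<gamma> powr \<alpha>)
        * (\<Sum>\<^sub>\<infinity>m\<in>UNIV. \<mu> p v w a b x m epowr \<alpha>)"
proof -
  let ?a = "approx_number p (hardy_steklov v w a b)"
  define M where "M m = enn2real (\<mu> p v w a b x m)" for m
  have M0: "0 \<le> M m" for m by (simp add: M_def)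
  have \<mu>_M: "\<mu> p v w a b x m = ennreal (M m)" for m
    by (simp add: M_def \<mu>_finite(3)[OF assms(1,3,4)])
  have \<gamma>0: "0 \<le> \<gamma>" using assms(5) by (simp add: norm_constant_def)
  define d where "d = 7 powr (1 / p) * (2 * \<gamma>)"
  have d0: "0 \<le> d" using \<gamma>0 by (simp add: d_def)
  define C where "C r = ennreal ((d * M (fst r) / real (Suc (snd r))) powr \<alpha>)" for r :: "int \<times> nat"
  have "(\<Sum>n. ?a (Suc n) epowr \<alpha>) \<le> (\<integral>\<^sup>+r. C r \<partial>count_space UNIV)"
  proof (rule sum_le_sum_by_counting)
    show "antimono (\<lambda>n. ?a (Suc n) epowr \<alpha>)"
      using assms(2) by (intro antimonoI epowr_mono antimonoD[OF approx_number_antimono]) auto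
  next
    fix t :: real assume t: "0 < t" and fin: "finite {r. ennreal t < C r}"
    define u where "u = t powr (1 / \<alpha>) / 7 powr (1 / p)"
    have u: "0 < u" using t by (simp add: u_def)
    have u_t: "7 powr (1 / p) * u = t powr (1 / \<alpha>)" by (simp add: u_def)
    have level: "{r. ennreal t < C r} = {(m, j). u < 2 * \<gamma> * enn2real (\<mu> p v w a b x m) / real (Suc j)}"
    proof -
      have "ennreal t < C (m, j) \<longleftrightarrow> u < 2 * \<gamma> * M m / real (Suc j)" for m j
      proof -
        define c where "c = d * M m / real (Suc j)"
        have c0: "0 \<le> c" using d0 M0 by (simp add: c_def)
        have "ennreal t < C (m, j) \<longleftrightarrow> (t powr (1 / \<alpha>)) powr \<alpha> < c powr \<alpha>"
          using t assms(2) by (simp add: C_def c_def ennreal_less_iff powr_powr)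
        also have "\<dots> \<longleftrightarrow> t powr (1 / \<alpha>) < c"
          using assms(2) c0 powr_less_mono2[of \<alpha> "t powr (1 / \<alpha>)" c] powr_mono2[of \<alpha> c "t powr (1 / \<alpha>)"]
          by (auto simp: not_less[symmetric])
        also have "\<dots> \<longleftrightarrow> 7 powr (1 / p) * u < 7 powr (1 / p) * (2 * \<gamma> * M m / real (Suc j))"
          unfolding u_t by (simp add: c_def d_def mult.assoc)
        also have "\<dots> \<longleftrightarrow> u < 2 * \<gamma> * M m / real (Suc j)" by (rule mult_less_cancel_left_pos) simp
        finally show ?thesis .
      qed
      then show ?thesis by (auto simp: M_def)
    qed
    have "?a (Suc (card {r. ennreal t < C r})) \<le> ennreal (7 powr (1 / p) * u)"
      unfolding level by (rule approx_number_threshold[OF assms(1,3,4,5) u fin[unfolded level]])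
    then have "?a (Suc (card {r. ennreal t < C r})) epowr \<alpha> \<le> ennreal (t powr (1 / \<alpha>)) epowr \<alpha>"
      unfolding u_t using assms(2) by (intro epowr_mono) auto
    also have "\<dots> = ennreal t" using t assms(2) by (simp add: powr_powr)
    finally show "?a (Suc (card {r. ennreal t < C r})) epowr \<alpha> \<le> ennreal t" .
  qed
  also have "\<dots> = (\<integral>\<^sup>+m. (\<integral>\<^sup>+j. C (m, j) \<partial>count_space UNIV) \<partial>count_space UNIV)"
    by (rule nn_integral_fst_count_space[symmetric])
  also have "\<dots> = (\<integral>\<^sup>+m. ennreal (d powr \<alpha> * zeta_real \<alpha>) * \<mu> p v w a b x m epowr \<alpha> \<partial>count_space UNIV)"
  proof (rule nn_integral_cong)
    fix m
    have "(\<integral>\<^sup>+j. C (m, j) \<partial>count_space UNIV) =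
        (\<Sum>j. ennreal ((d * M m) powr \<alpha>) * ennreal (1 / real (Suc j) powr \<alpha>))"
      using d0 M0 by (simp add: nn_integral_count_space_nat C_def powr_divide flip: ennreal_mult)
    also have "\<dots> = ennreal ((d * M m) powr \<alpha>) * ennreal (zeta_real \<alpha>)"
      unfolding ennreal_suminf_cmult suminf_zeta(1)[OF assms(2)] ..
    also have "\<dots> = ennreal (d powr \<alpha> * zeta_real \<alpha>) * \<mu> p v w a b x m epowr \<alpha>"
      using d0 M0 suminf_zeta(2)[OF assms(2)]
      by (simp add: \<mu>_M powr_mult mult.commute mult.left_commute flip: ennreal_mult)
    finally show "(\<integral>\<^sup>+j. C (m, j) \<partial>count_space UNIV) =
        ennreal (d powr \<alpha> * zeta_real \<alpha>) * \<mu> p v w a b x m epowr \<alpha>" .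
  qed
  also have "\<dots> = ennreal (d powr \<alpha> * zeta_real \<alpha>) * (\<integral>\<^sup>+m. \<mu> p v w a b x m epowr \<alpha> \<partial>count_space UNIV)"
    by (rule nn_integral_cmult) simp
  also have "\<dots> \<le> ennreal (d powr \<alpha> * zeta_real \<alpha>) * (\<Sum>\<^sub>\<infinity>m\<in>UNIV. \<mu> p v w a b x m epowr \<alpha>)"
    by (intro mult_left_mono nn_integral_count_space_int_le_infsum) simp
  also have "d powr \<alpha> * zeta_real \<alpha> = 2 powr \<alpha> * zeta_real \<alpha> * 7 powr (\<alpha> / p) * \<gamma> powr \<alpha>"
    using \<gamma>0 by (simp add: d_def powr_mult powr_powr)
  finally show ?thesis .
qed

end
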